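(* Let $p\ge2$. Then the limit of $\lambda_M^1(\Omega_\ell)$ as $\ell\to\infty$ exists and $$\lim_{\ell\to\infty}\lambda_M^1(\Omega_\ell)=\min\{\nu_\infty^+,\nu_\infty^-\}.$$
   Context: Let $n\ge2$ and let $\omega\subset\mathbb{R}^{n-1}$ be a bounded open set. Points of $\mathbb{R}^n$ are written $x=(x_1,X_2)$ with $x_1\in\mathbb{R}$, $X_2\in\mathbb{R}^{n-1}$. For $\ell>0$, $\Omega_\ell=(-\ell,\ell)\times\omega$ and $\gamma_\ell=(-\ell,\ell)\times\partial\omega$. Also $\Omega_\infty^+=(0,\infty)\times\omega$, $\Omega_\infty^-=(-\infty,0)\times\omega$, $\gamma_\infty^+=(0,\infty)\times\partial\omega$, $\gamma_\infty^-=(-\infty,0)\times\partial\omega$. $A=A(X_2)$, $X_2\in\omega$, is a symmetric $n\times n$ matrix with bounded measurable entries. There are constants $C,\lambda>0$ such that $\|A(X_2)\|\le C$ and $A(X_2)\xi\cdot\xi\ge\lambda|\xi|^2$ for a.e. $X_2\in\omega$ and all $\xi\in\mathbb{R}^n$. $V(\Omega_\ell)=\{v\in W^{1,p}(\Omega_\ell): v=0\text{ on }\gamma_\ell\}$ and $V(\Omega_\infty^\pm)=\{u\in W^{1,p}(\Omega_\infty^\pm):u=0\text{ on }\gamma_\infty^\pm\}$ (in the sense of traces). Define $$\lambda_M^1(\Omega_\ell)=\inf_{0\ne u\in V(\Omega_\ell)}\frac{\int_{\Omega_\ell}|A\nabla u\cdot\nabla u|^{p/2}}{\int_{\Omega_\ell}|u|^p},\qquad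 \nu_\infty^\pm=\inf_{0\ne u\in V(\Omega_\infty^\pm)}\frac{\int_{\Omega_\infty^\pm}|A\nabla u\cdot\nabla u|^{p/2}}{\int_{\Omega_\infty^\pm}|u|^p}.$$ ($\lambda_M^1(\Omega_\ell)$ is the first eigenvalue of $-\mathrm{div}(|A\nabla u\cdot\nabla u|^{\frac{p-2}{2}}A\nabla u)=\lambda|u|^{p-2}u$ in $\Omega_\ell$, $u=0$ on $\gamma_\ell$, $(A\nabla u)\cdot\nu=0$ on $\{-\ell,\ell\}\times\omega$.) *)

theory Defs
  imports "HOL-Analysis.Analysis"
begin

text \<open>Sobolev functions on a set \<open>U\<close> are handled as pairs \<open>(u, g)\<close> of a function and a weak
  gradient of it; \<open>g\<close> is determined by \<open>u\<close> almost everywhere on \<open>U\<close>, and only the values on \<open>U\<close>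
  matter.\<close>

definition Lp_fun :: "real \<Rightarrow> 'a::euclidean_space set \<Rightarrow> ('a \<Rightarrow> 'b::euclidean_space) \<Rightarrow> bool" where
  "Lp_fun p U f \<longleftrightarrow> f \<in> borel_measurable (lebesgue_on U) \<and>
     integrable (lebesgue_on U) (\<lambda>x. norm (f x) powr p)"

text \<open>Test functions are the \<open>C\<^sup>1\<close> functions with compact support in \<open>U\<close>, as in Gilbarg and
  Trudinger, Section 7.3.\<close>

definition test_fun :: "'a::euclidean_space set \<Rightarrow> ('a \<Rightarrow> real) \<Rightarrow> ('a \<Rightarrow> 'a) \<Rightarrow> bool" where
  "test_fun U \<phi> \<phi>' \<longleftrightarrow> (\<forall>x. GDERIV \<phi> x :> \<phi>' x) \<and> continuous_on UNIV \<phi>' \<and>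
     (\<exists>K. compact K \<and> K \<subseteq> U \<and> (\<forall>x. x \<notin> K \<longrightarrow> \<phi> x = 0))"

text \<open>Used only for \<open>u\<close> and \<open>g\<close> in \<open>L\<^sup>p\<close> with \<open>p \<ge> 1\<close>, where both integrals converge.\<close>

definition weak_gradient :: "'a::euclidean_space set \<Rightarrow> ('a \<Rightarrow> real) \<Rightarrow> ('a \<Rightarrow> 'a) \<Rightarrow> bool" where
  "weak_gradient U u g \<longleftrightarrow> (\<forall>\<phi> \<phi>'. test_fun U \<phi> \<phi>' \<longrightarrow>
     (LINT x|lebesgue_on U. u x *\<^sub>R \<phi>' x) = - (LINT x|lebesgue_on U. \<phi> x *\<^sub>R g x))"

definition W1p :: "real \<Rightarrow> 'a::euclidean_space set \<Rightarrow> (('a \<Rightarrow> real) \<times> ('a \<Rightarrow> 'a)) set" where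
  "W1p p U = {(u, g). Lp_fun p U u \<and> Lp_fun p U g \<and> weak_gradient U u g}"

definition W1p_tendsto :: "real \<Rightarrow> 'a::euclidean_space set \<Rightarrow>
    (nat \<Rightarrow> ('a \<Rightarrow> real) \<times> ('a \<Rightarrow> 'a)) \<Rightarrow> ('a \<Rightarrow> real) \<times> ('a \<Rightarrow> 'a) \<Rightarrow> bool" where
  "W1p_tendsto p U w w0 \<longleftrightarrow>
     (\<lambda>k. LINT x|lebesgue_on U. \<bar>fst (w k) x - fst w0 x\<bar> powr p) \<longlonglongrightarrow> 0 \<and>
     (\<lambda>k. LINT x|lebesgue_on U. norm (snd (w k) x - snd w0 x) powr p) \<longlonglongrightarrow> 0"

text \<open>Zero trace on a part \<open>\<gamma>\<close> of the boundary. The boundary is not assumed to be regular, so there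
  is no trace operator into a function space on \<open>\<gamma>\<close>; the functions of zero trace are the
  \<open>W\<^sup>1\<^sup>,\<^sup>p\<close>-limits of Sobolev functions that are continuous on the closure of \<open>U\<close> and vanish
  pointwise on \<open>\<gamma>\<close>.\<close>

definition W1p_zero_trace ::
    "real \<Rightarrow> 'a::euclidean_space set \<Rightarrow> 'a set \<Rightarrow> (('a \<Rightarrow> real) \<times> ('a \<Rightarrow> 'a)) set" where
  "W1p_zero_trace p U \<gamma> = {w \<in> W1p p U. \<exists>v.
     (\<forall>k. v k \<in> W1p p U \<and> continuous_on (closure U) (fst (v k)) \<and> (\<forall>x\<in>\<gamma>. fst (v k) x = 0)) \<and>
     W1p_tendsto p U v w}"

text \<open>Points \<open>x = (x\<^sub>1, X\<^sub>2)\<close> of \<open>\<real>\<^sup>n\<close> are vectors indexed by \<open>'m option\<close>, where \<open>CARD('m) = n - 1\<close>: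
  the index \<open>None\<close> carries \<open>x\<^sub>1\<close> and the indices \<open>Some i\<close> carry \<open>X\<^sub>2\<close>.\<close>

definition tail :: "real ^ ('m::finite option) \<Rightarrow> real ^ 'm" where
  "tail x = (\<chi> i. x $ Some i)"

definition cylinder :: "real set \<Rightarrow> (real ^ 'm::finite) set \<Rightarrow> (real ^ ('m option)) set" where
  "cylinder I S = {x. x $ None \<in> I \<and> tail x \<in> S}"

definition V_space :: "real \<Rightarrow> (real ^ 'm::finite) set \<Rightarrow> real set \<Rightarrow>
    ((real ^ ('m option) \<Rightarrow> real) \<times> (real ^ ('m option) \<Rightarrow> real ^ ('m option))) set" where
  "V_space p \<omega> I = W1p_zero_trace p (cylinder I \<omega>) (cylinder I (frontier \<omega>))"

definition rayleigh :: "real \<Rightarrow> (real ^ 'm::finite \<Rightarrow> real ^ ('m option) ^ ('m option)) \<Rightarrow>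
    (real ^ ('m option)) set \<Rightarrow> (real ^ ('m option) \<Rightarrow> real) \<Rightarrow>
    (real ^ ('m option) \<Rightarrow> real ^ ('m option)) \<Rightarrow> real" where
  "rayleigh p A U u g =
     (LINT x|lebesgue_on U. \<bar>(A (tail x) *v g x) \<bullet> g x\<bar> powr (p / 2)) /
     (LINT x|lebesgue_on U. \<bar>u x\<bar> powr p)"

definition inf_rayleigh :: "real \<Rightarrow> (real ^ 'm::finite \<Rightarrow> real ^ ('m option) ^ ('m option)) \<Rightarrow>
    (real ^ 'm) set \<Rightarrow> real set \<Rightarrow> real" where
  "inf_rayleigh p A \<omega> I = Inf {rayleigh p A (cylinder I \<omega>) u g | u g.
     (u, g) \<in> V_space p \<omega> I \<and> \<not> (AE x in lebesgue_on (cylinder I \<omega>). u x = 0)}"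

definition lambda_M :: "real \<Rightarrow> (real ^ 'm::finite \<Rightarrow> real ^ ('m option) ^ ('m option)) \<Rightarrow>
    (real ^ 'm) set \<Rightarrow> real \<Rightarrow> real" where
  "lambda_M p A \<omega> l = inf_rayleigh p A \<omega> {- l<..<l}"

definition nu_plus :: "real \<Rightarrow> (real ^ 'm::finite \<Rightarrow> real ^ ('m option) ^ ('m option)) \<Rightarrow>
    (real ^ 'm) set \<Rightarrow> real" where
  "nu_plus p A \<omega> = inf_rayleigh p A \<omega> {0<..}"

definition nu_minus :: "real \<Rightarrow> (real ^ 'm::finite \<Rightarrow> real ^ ('m option) ^ ('m option)) \<Rightarrow>
    (real ^ 'm) set \<Rightarrow> real" where
  "nu_minus p A \<omega> = inf_rayleigh p A \<omega> {..<0}"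

end

theory Submission
  imports Defs
begin

text \<open>Both inequalities are obtained by transplanting functions between cylinders.

Translation along the axis changes neither the energy nor the mass, because \<open>A\<close> depends on
\<open>X\<^sub>2\<close> alone. So \<open>(-l,l)\<close> may be replaced by \<open>(0,2l)\<close> or \<open>(-2l,0)\<close>. Upper bound
(\<open>rayleigh_quotients_exhaustion\<close>): if \<open>u\<close> is a competitor on a half-cylinder, its
restriction to the piece of length \<open>2l\<close> is a competitor there, of no larger energy, and its mass
tends to that of \<open>u\<close>. Hence the upper limit is at most both half-cylinder infima.

Lower bound (\<open>rayleigh_quotient_lower_bound\<close>): let \<open>u\<close> be a competitor on
\<open>(0,L)\<close> with \<open>L > N + 1\<close>. Among \<open>N\<close> disjoint unit slabs, one carries at most the
fraction \<open>1/N\<close> of \<open>\<integral> |u|\<^sup>p + |\<nabla>u|\<^sup>p\<close> (\<open>pigeonhole_slab\<close>). A partition of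
unity in \<open>x\<^sub>1\<close> that changes only inside this slab splits \<open>u\<close> into a left part,
extended by zero to \<open>(0,\<infinity>)\<close>, and a right part, extended by zero to \<open>(-\<infinity>,L)\<close>
(\<open>split_along_slab\<close>). With \<open>m\<close> the smaller half-cylinder infimum, both parts have energy at
least \<open>m\<close> times their mass. The total mass and energy differ from those of \<open>u\<close> by at most a
multiple of the content of the slab. By coercivity that content is at most a constant times
\<open>(mass + energy) / N\<close>. So every Rayleigh quotient \<open>q\<close> on \<open>(0,L)\<close> satisfies
\<open>m \<le> q + const (1 + const q) / N\<close>, and \<open>N\<close> may be taken large as \<open>L\<close> grows.

The Sobolev part consists of two closure properties of the spaces with zero lateral trace:
multiplication by a \<open>C\<^sup>1\<close> cutoff, which at the same time restricts or extends by zero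
(\<open>W1p_zero_trace_mult\<close>), and translation (\<open>W1p_zero_trace_shift\<close>). Since \<open>A\<close> is only
Lebesgue measurable in \<open>X\<^sub>2\<close>, the measurability of the energy density further rests on the fact
that cylinders over null sets are null (\<open>null_sets_tail_vimage\<close>).\<close>

section \<open>Integrals and \<open>L\<^sup>p\<close> bounds on subsets\<close>

text \<open>Integrals over two sets agree for functions that vanish outside their intersection. All
extensions by zero below are of this kind: the cutoff already vanishes on the new part of the domain,
so no case distinction enters the extended function.\<close>
lemma lebesgue_on_eq_off_common_part:
  fixes f :: "'a::euclidean_space \<Rightarrow> 'b::euclidean_space"
  assumes U: "U \<in> sets lebesgue" and U': "U' \<in> sets lebesgue"
    and 0: "\<And>x. x \<in> U \<Longrightarrow> x \<notin> U' \<Longrightarrow> f x = 0" "\<And>x. x \<in> U' \<Longrightarrow> x \<notin> U \<Longrightarrow> f x = 0"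
  shows "integrable (lebesgue_on U) f \<longleftrightarrow> integrable (lebesgue_on U') f"
    and "integral\<^sup>L (lebesgue_on U) f = integral\<^sup>L (lebesgue_on U') f"
    and "f \<in> borel_measurable (lebesgue_on U) \<longleftrightarrow> f \<in> borel_measurable (lebesgue_on U')"
proof -
  have eq: "(\<lambda>x. if x \<in> U then f x else 0) = (\<lambda>x. if x \<in> U' then f x else 0)"
    using 0 by auto
  show "integrable (lebesgue_on U) f \<longleftrightarrow> integrable (lebesgue_on U') f"
    using eq Lebesgue_Measure.integrable_restrict_UNIV[OF U, of f] Lebesgue_Measure.integrable_restrict_UNIV[OF U', of f] by simp
  show "integral\<^sup>L (lebesgue_on U) f = integral\<^sup>L (lebesgue_on U') f"
    using eq Lebesgue_Measure.integral_restrict_UNIV[OF U, of f] Lebesgue_Measure.integral_restrict_UNIV[OF U', of f] by simp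
  show "f \<in> borel_measurable (lebesgue_on U) \<longleftrightarrow> f \<in> borel_measurable (lebesgue_on U')"
    using eq borel_measurable_if[OF U, of f] borel_measurable_if[OF U', of f] by simp
qed

lemma powr_add_le:
  fixes a b p :: real
  assumes "0 \<le> a" "0 \<le> b" "0 \<le> p"
  shows "(a + b) powr p \<le> 2 powr p * (a powr p + b powr p)"
proof -
  have "(a + b) powr p \<le> (2 * max a b) powr p"
    using assms by (intro powr_mono2) auto
  also have "\<dots> = 2 powr p * max a b powr p"
    using assms by (simp add: powr_mult)
  also have "\<dots> \<le> 2 powr p * (a powr p + b powr p)"
    by (intro mult_left_mono) (auto simp: max_def)
  finally show ?thesis .
qed

lemma Lp_fun_dominated:
  fixes f :: "'a::euclidean_space \<Rightarrow> 'b::euclidean_space"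
  assumes "f \<in> borel_measurable (lebesgue_on U)" "integrable (lebesgue_on U) h"
    and "\<And>x. x \<in> U \<Longrightarrow> norm (f x) powr p \<le> h x"
  shows "Lp_fun p U f"
  unfolding Lp_fun_def
proof
  show "integrable (lebesgue_on U) (\<lambda>x. norm (f x) powr p)"
    by (rule Bochner_Integration.integrable_bound[OF assms(2)])
       (use assms in \<open>auto intro!: AE_I2 order_trans[OF assms(3) abs_ge_self]\<close>)
qed fact

lemma Lp_fun_diff:
  fixes f h :: "'a::euclidean_space \<Rightarrow> 'b::euclidean_space"
  assumes "Lp_fun p U f" "Lp_fun p U h" "0 \<le> p"
  shows "Lp_fun p U (\<lambda>x. f x - h x)"
proof (rule Lp_fun_dominated[where h = "\<lambda>x. 2 powr p * (norm (f x) powr p + norm (h x) powr p)"])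
  show "norm (f x - h x) powr p \<le> 2 powr p * (norm (f x) powr p + norm (h x) powr p)" for x
    using powr_add_le[of "norm (f x)" "norm (h x)" p] assms(3)
      powr_mono2[OF assms(3) norm_ge_zero norm_triangle_ineq4[of "f x" "h x"]] by simp
qed (use assms in \<open>auto simp: Lp_fun_def\<close>)

lemma norm_cutoff_gradient_powr_le:
  fixes g e :: "'a::euclidean_space" and u \<eta> :: real
  assumes "\<bar>\<eta>\<bar> \<le> 1" "norm e \<le> B" "0 \<le> p"
  shows "norm (\<eta> *\<^sub>R g + u *\<^sub>R e) powr p \<le> 2 powr p * (norm g powr p + B powr p * \<bar>u\<bar> powr p)"
proof -
  have B: "0 \<le> B"
    using assms(2) norm_ge_zero order_trans by blast
  have "norm (\<eta> *\<^sub>R g + u *\<^sub>R e) \<le> norm g + B * \<bar>u\<bar>"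
    using norm_triangle_ineq[of "\<eta> *\<^sub>R g" "u *\<^sub>R e"] mult_right_mono[OF assms(1), of "norm g"]
      mult_left_mono[OF assms(2), of "\<bar>u\<bar>"] by (simp add: mult.commute)
  then have "norm (\<eta> *\<^sub>R g + u *\<^sub>R e) powr p \<le> (norm g + B * \<bar>u\<bar>) powr p"
    using assms by (intro powr_mono2) auto
  also have "\<dots> \<le> 2 powr p * (norm g powr p + (B * \<bar>u\<bar>) powr p)"
    using assms B by (intro powr_add_le) auto
  finally show ?thesis
    using B by (simp add: powr_mult)
qed

text \<open>The defining identity of a weak gradient may be split into separate integrals because
\<open>L\<^sup>p\<close> functions are integrable against continuous functions of compact support. For
\<open>p \<ge> 1\<close> one has \<open>|u| \<le> 1 + |u|\<^sup>p\<close>, and the constant is integrable over a compact set.\<close>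

lemma Lp_fun_imp_integrable_on_compact:
  fixes u :: "'a::euclidean_space \<Rightarrow> 'b::euclidean_space"
  assumes "Lp_fun p U u" "1 \<le> p" "U \<in> sets lebesgue" "compact K"
  shows "integrable (lebesgue_on U) (\<lambda>x. indicator K x * norm (u x))"
proof -
  have [measurable]: "u \<in> borel_measurable (lebesgue_on U)"
    using assms by (simp add: Lp_fun_def)
  have K: "K \<in> sets lebesgue" "emeasure lebesgue K < \<infinity>"
    using assms(4) emeasure_compact_finite[of K] by (auto simp: borel_compact)
  have mK: "K \<inter> U \<in> sets (lebesgue_on U)"
    using K(1) assms(3) by (auto simp: sets_restrict_space)
  have "emeasure (lebesgue_on U) (K \<inter> U) < \<infinity>"
    using K assms(3) emeasure_mono[of "K \<inter> U" K lebesgue]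
    by (auto simp: emeasure_restrict_space intro: le_less_trans)
  then have 1: "integrable (lebesgue_on U) (indicator (K \<inter> U) :: _ \<Rightarrow> real)"
    using mK by (intro integrable_real_indicator) auto
  have mI: "(indicator K :: _ \<Rightarrow> real) \<in> borel_measurable (lebesgue_on U)"
    using K(1) by (intro measurable_restrict_space1) simp
  have "x powr 1 \<le> 1 + x powr p" if "0 \<le> x" for x :: real
    using powr_mono[of 1 p x] assms(2) that powr_ge_zero[of x p]
    by (cases "x \<le> 1") (simp_all add: add_increasing2)
  then have le: "x \<le> 1 + x powr p" if "0 \<le> x" for x :: real
    using that by (metis powr_one)
  have m: "(\<lambda>x. indicator K x * norm (u x)) \<in> borel_measurable (lebesgue_on U)"
    using mI by measurable
  show ?thesis
    by (rule Bochner_Integration.integrable_bound[OF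
          Bochner_Integration.integrable_add[OF 1, of "\<lambda>x. norm (u x) powr p"] m])
       (use assms in \<open>auto simp: Lp_fun_def indicator_def intro!: AE_I2 le\<close>)
qed

lemma GDERIV_eq_0_outside_closed:
  assumes "\<And>x. GDERIV \<phi> x :> \<phi>' x" "closed K" "\<And>x. x \<notin> K \<Longrightarrow> \<phi> x = 0" "x \<notin> K"
  shows "\<phi>' x = 0"
proof -
  have "(\<phi> has_derivative (\<lambda>h. inner h (\<phi>' x))) (at x)"
    using assms(1) by (simp add: gderiv_def)
  moreover have "(\<phi> has_derivative (\<lambda>h. 0)) (at x)"
    by (rule has_derivative_transform_within_open[of "\<lambda>_. 0" _ _ _ "- K"])
       (use assms in auto)
  ultimately have "(\<lambda>h. inner h (\<phi>' x)) = (\<lambda>h. 0)"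
    by (rule has_derivative_unique)
  then show ?thesis
    by (metis inner_eq_zero_iff)
qed

lemma GDERIV_imp_continuous_on:
  assumes "\<And>x. GDERIV \<phi> x :> \<phi>' x"
  shows "continuous_on S \<phi>"
  using assms unfolding gderiv_def
  by (meson continuous_at_imp_continuous_on has_derivative_continuous)

text \<open>The product is an arbitrary bilinear map so as to cover both \<open>u \<nabla>\<phi>\<close> and \<open>\<phi> \<nabla>u\<close>.\<close>

lemma Lp_fun_mult_compact_support_integrable:
  fixes u :: "'a::euclidean_space \<Rightarrow> 'b::euclidean_space" and \<phi> :: "'a \<Rightarrow> 'c::euclidean_space"
    and m :: "'b \<Rightarrow> 'c \<Rightarrow> 'd::euclidean_space"
  assumes "Lp_fun p U u" "1 \<le> p" "U \<in> sets lebesgue" "compact K"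
    and "continuous_on UNIV \<phi>" "\<And>x. x \<notin> K \<Longrightarrow> \<phi> x = 0"
    and m: "bounded_bilinear m"
  shows "integrable (lebesgue_on U) (\<lambda>x. m (u x) (\<phi> x))"
proof -
  obtain Q where Q: "\<And>a b. norm (m a b) \<le> norm a * norm b * Q" "0 \<le> Q"
    using bounded_bilinear.nonneg_bounded[OF m] by auto
  obtain M where M: "\<And>x. x \<in> K \<Longrightarrow> norm (\<phi> x) \<le> M"
    using compact_imp_bounded[OF compact_continuous_image[OF continuous_on_subset[OF assms(5)] assms(4)]]
    unfolding bounded_iff by auto
  have [measurable]: "u \<in> borel_measurable (lebesgue_on U)"
    using assms by (simp add: Lp_fun_def)
  have "\<phi> \<in> borel_measurable borel"
    using assms(5) by (rule borel_measurable_continuous_onI)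
  then have [measurable]: "\<phi> \<in> borel_measurable (lebesgue_on U)"
    by (intro measurable_restrict_space1 measurable_completion) simp
  have "continuous_on UNIV (\<lambda>z. m (fst z) (snd z))"
    by (intro bounded_bilinear.continuous_on[OF m] continuous_intros)
  then have "(\<lambda>z. m (fst z) (snd z)) \<in> borel_measurable borel"
    by (rule borel_measurable_continuous_onI)
  then have meas: "(\<lambda>x. m (u x) (\<phi> x)) \<in> borel_measurable (lebesgue_on U)"
    using measurable_compose[of "\<lambda>x. (u x, \<phi> x)" "lebesgue_on U" borel
        "\<lambda>z. m (fst z) (snd z)" borel] by simp
  show ?thesis
  proof (rule Bochner_Integration.integrable_bound[OF
        integrable_mult_left[OF Lp_fun_imp_integrable_on_compact[OF assms(1-4)], of "\<bar>M\<bar> * Q"] meas],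
      intro AE_I2)
    fix x
    show "norm (m (u x) (\<phi> x)) \<le> norm (indicator K x * norm (u x) * (\<bar>M\<bar> * Q))"
    proof (cases "x \<in> K")
      case True
      have "norm (m (u x) (\<phi> x)) \<le> norm (u x) * norm (\<phi> x) * Q"
        by (rule Q)
      also have "\<dots> \<le> norm (u x) * \<bar>M\<bar> * Q"
        using M[OF True] Q by (intro mult_right_mono mult_left_mono) auto
      finally show ?thesis
        using True Q by (simp add: abs_mult mult_ac)
    next
      case False
      then show ?thesis
        using assms(6) by (simp add: bounded_bilinear.zero_right[OF m])
    qed
  qed
qed

section \<open>Cutoffs of Sobolev functions with zero trace\<close>

text \<open>\<open>F\<close> contains the support of \<open>\<eta>\<close>. To carry a function from \<open>U\<close> to \<open>U'\<close> it
suffices that \<open>U' \<inter> F \<subseteq> U\<close>: the product with \<open>\<eta>\<close> vanishes on the rest of \<open>U'\<close>.\<close>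
locale cutoff =
  fixes \<eta> :: "'a::euclidean_space \<Rightarrow> real" and \<eta>' :: "'a \<Rightarrow> 'a" and B :: real and F :: "'a set"
  assumes GDERIV_cutoff: "\<And>x. GDERIV \<eta> x :> \<eta>' x"
    and continuous_gradient: "continuous_on UNIV \<eta>'"
    and abs_cutoff_le: "\<And>x. \<bar>\<eta> x\<bar> \<le> 1"
    and norm_gradient_le: "\<And>x. norm (\<eta>' x) \<le> B"
    and closed_support: "closed F"
    and cutoff_eq_0: "\<And>x. x \<notin> F \<Longrightarrow> \<eta> x = 0"
begin

lemma gradient_eq_0: "x \<notin> F \<Longrightarrow> \<eta>' x = 0"
  using GDERIV_eq_0_outside_closed[OF GDERIV_cutoff closed_support cutoff_eq_0] .

lemma continuous_cutoff: "continuous_on S \<eta>"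
  using GDERIV_imp_continuous_on GDERIV_cutoff .

lemma measurable_cutoff [measurable]:
  "\<eta> \<in> borel_measurable (lebesgue_on U)" "\<eta>' \<in> borel_measurable (lebesgue_on U)"
  by (intro measurable_restrict_space1 measurable_completion,
      simp add: borel_measurable_continuous_onI continuous_cutoff continuous_gradient)+

text \<open>This is why a cutoff can extend across part of the boundary of \<open>U\<close>: \<open>\<eta>\<phi>\<close> is supported
in \<open>K \<inter> F\<close>, a compact subset of \<open>U\<close>, even when \<open>\<phi>\<close> is a test function on the larger
set \<open>U'\<close>.\<close>
lemma test_fun_mult:
  assumes "test_fun U' \<phi> \<phi>'" "U' \<inter> F \<subseteq> U"
  shows "test_fun U (\<lambda>x. \<eta> x * \<phi> x) (\<lambda>x. \<eta> x *\<^sub>R \<phi>' x + \<phi> x *\<^sub>R \<eta>' x)"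
proof -
  have \<phi>: "\<And>x. GDERIV \<phi> x :> \<phi>' x" "continuous_on UNIV \<phi>'"
    using assms(1) by (auto simp: test_fun_def)
  obtain K where K: "compact K" "K \<subseteq> U'" "\<And>x. x \<notin> K \<Longrightarrow> \<phi> x = 0"
    using assms(1) by (auto simp: test_fun_def)
  show ?thesis
    unfolding test_fun_def
  proof (intro conjI allI exI[of _ "K \<inter> F"] impI)
    show "GDERIV (\<lambda>x. \<eta> x * \<phi> x) x :> \<eta> x *\<^sub>R \<phi>' x + \<phi> x *\<^sub>R \<eta>' x" for x
      by (rule GDERIV_mult[OF GDERIV_cutoff \<phi>(1)])
    show "continuous_on UNIV (\<lambda>x. \<eta> x *\<^sub>R \<phi>' x + \<phi> x *\<^sub>R \<eta>' x)"
      by (intro continuous_intros continuous_cutoff continuous_gradient \<phi>(2)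
          GDERIV_imp_continuous_on[OF \<phi>(1)])
    show "compact (K \<inter> F)"
      using K(1) closed_support by (rule compact_Int_closed)
    show "K \<inter> F \<subseteq> U"
      using K(2) assms(2) by auto
    show "\<eta> x * \<phi> x = 0" if "x \<notin> K \<inter> F" for x
      using that K(3) cutoff_eq_0 by auto
  qed
qed

text \<open>Test the weak gradient of \<open>u\<close> with \<open>\<eta>\<phi>\<close> and move the term \<open>u \<phi> \<nabla>\<eta>\<close> to
the other side.\<close>
lemma weak_gradient_mult:
  assumes u: "Lp_fun p U u" and g: "Lp_fun p U g" and p: "1 \<le> p"
    and U: "U \<in> sets lebesgue" and U': "U' \<in> sets lebesgue" and sub: "U' \<inter> F \<subseteq> U"
    and wg: "weak_gradient U u g"
  shows "weak_gradient U' (\<lambda>x. \<eta> x * u x) (\<lambda>x. \<eta> x *\<^sub>R g x + u x *\<^sub>R \<eta>' x)"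
  unfolding weak_gradient_def
proof (intro allI impI)
  fix \<phi> \<phi>' assume t: "test_fun U' \<phi> \<phi>'"
  have \<phi>: "\<And>x. GDERIV \<phi> x :> \<phi>' x" "continuous_on UNIV \<phi>'" "continuous_on UNIV \<phi>"
    using t by (auto simp: test_fun_def intro: GDERIV_imp_continuous_on)
  obtain K where K: "compact K" "K \<subseteq> U'" "\<And>x. x \<notin> K \<Longrightarrow> \<phi> x = 0"
    using t by (auto simp: test_fun_def)
  have K': "x \<notin> K \<Longrightarrow> \<phi>' x = 0" for x
    using GDERIV_eq_0_outside_closed[OF \<phi>(1) compact_imp_closed[OF K(1)] K(3)] .
  note int = Lp_fun_mult_compact_support_integrable[OF _ p U K(1)]
  have i1: "integrable (lebesgue_on U) (\<lambda>x. u x *\<^sub>R (\<eta> x *\<^sub>R \<phi>' x))"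
    by (rule int[OF u _ _ bounded_bilinear_scaleR])
       (auto intro!: continuous_intros continuous_cutoff \<phi> simp: K')
  have i2: "integrable (lebesgue_on U) (\<lambda>x. u x *\<^sub>R (\<phi> x *\<^sub>R \<eta>' x))"
    by (rule int[OF u _ _ bounded_bilinear_scaleR])
       (auto intro!: continuous_intros continuous_gradient \<phi> simp: K)
  have i3: "integrable (lebesgue_on U) (\<lambda>x. (\<eta> x * \<phi> x) *\<^sub>R g x)"
    by (rule int[OF g _ _ bounded_bilinear.flip[OF bounded_bilinear_scaleR]])
       (auto intro!: continuous_intros continuous_cutoff \<phi> simp: K)
  have "(LINT x|lebesgue_on U'. (\<eta> x * u x) *\<^sub>R \<phi>' x) = (LINT x|lebesgue_on U. (\<eta> x * u x) *\<^sub>R \<phi>' x)"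
    using sub K(2) by (intro lebesgue_on_eq_off_common_part[OF U' U])
      (use K' cutoff_eq_0 in \<open>force+\<close>)
  also have "\<dots> = (LINT x|lebesgue_on U. u x *\<^sub>R (\<eta> x *\<^sub>R \<phi>' x + \<phi> x *\<^sub>R \<eta>' x) - u x *\<^sub>R (\<phi> x *\<^sub>R \<eta>' x))"
    by (simp add: algebra_simps)
  also have "\<dots> = (LINT x|lebesgue_on U. u x *\<^sub>R (\<eta> x *\<^sub>R \<phi>' x + \<phi> x *\<^sub>R \<eta>' x)) -
      (LINT x|lebesgue_on U. u x *\<^sub>R (\<phi> x *\<^sub>R \<eta>' x))"
    using Bochner_Integration.integrable_add[OF i1 i2] i2
    by (intro Bochner_Integration.integral_diff) (simp_all add: scaleR_add_right)
  also have "(LINT x|lebesgue_on U. u x *\<^sub>R (\<eta> x *\<^sub>R \<phi>' x + \<phi> x *\<^sub>R \<eta>' x)) =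
      - (LINT x|lebesgue_on U. (\<eta> x * \<phi> x) *\<^sub>R g x)"
    using wg test_fun_mult[OF t sub] by (auto simp: weak_gradient_def)
  also have "\<dots> - (LINT x|lebesgue_on U. u x *\<^sub>R (\<phi> x *\<^sub>R \<eta>' x)) =
      - (LINT x|lebesgue_on U. (\<eta> x * \<phi> x) *\<^sub>R g x + u x *\<^sub>R (\<phi> x *\<^sub>R \<eta>' x))"
    by (subst Bochner_Integration.integral_add[OF i3 i2]) simp
  also have "(LINT x|lebesgue_on U. (\<eta> x * \<phi> x) *\<^sub>R g x + u x *\<^sub>R (\<phi> x *\<^sub>R \<eta>' x)) =
      (LINT x|lebesgue_on U. \<phi> x *\<^sub>R (\<eta> x *\<^sub>R g x + u x *\<^sub>R \<eta>' x))"
    by (simp add: algebra_simps)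
  also have "\<dots> = (LINT x|lebesgue_on U'. \<phi> x *\<^sub>R (\<eta> x *\<^sub>R g x + u x *\<^sub>R \<eta>' x))"
    using sub K(2) by (intro lebesgue_on_eq_off_common_part[OF U U'])
      (use K(3) cutoff_eq_0 gradient_eq_0 in \<open>force+\<close>)
  finally show "(LINT x|lebesgue_on U'. (\<eta> x * u x) *\<^sub>R \<phi>' x) =
      - (LINT x|lebesgue_on U'. \<phi> x *\<^sub>R (\<eta> x *\<^sub>R g x + u x *\<^sub>R \<eta>' x))" .
qed

lemma measurable_mult:
  assumes [measurable]: "u \<in> borel_measurable (lebesgue_on U)" "g \<in> borel_measurable (lebesgue_on U)"
    and U: "U \<in> sets lebesgue" and U': "U' \<in> sets lebesgue" and sub: "U' \<inter> F \<subseteq> U"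
  shows "(\<lambda>x. \<eta> x * u x) \<in> borel_measurable (lebesgue_on U')"
    and "(\<lambda>x. \<eta> x *\<^sub>R g x + u x *\<^sub>R \<eta>' x) \<in> borel_measurable (lebesgue_on U')"
proof -
  have I: "U \<inter> U' \<in> sets lebesgue"
    using U U' by auto
  have 0: "\<eta> x = 0" "\<eta>' x = 0" if "x \<in> U'" "x \<notin> U" for x
    using sub that cutoff_eq_0 gradient_eq_0 by auto
  have "(\<lambda>x. \<eta> x * u x) \<in> borel_measurable (lebesgue_on U)"
    by measurable
  then have "(\<lambda>x. \<eta> x * u x) \<in> borel_measurable (lebesgue_on (U \<inter> U'))"
    by (rule measurable_restrict_mono) simp
  then show "(\<lambda>x. \<eta> x * u x) \<in> borel_measurable (lebesgue_on U')"
    by (subst lebesgue_on_eq_off_common_part(3)[OF U' I]) (auto simp: 0)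
  have "(\<lambda>x. \<eta> x *\<^sub>R g x + u x *\<^sub>R \<eta>' x) \<in> borel_measurable (lebesgue_on U)"
    by measurable
  then have "(\<lambda>x. \<eta> x *\<^sub>R g x + u x *\<^sub>R \<eta>' x) \<in> borel_measurable (lebesgue_on (U \<inter> U'))"
    by (rule measurable_restrict_mono) simp
  then show "(\<lambda>x. \<eta> x *\<^sub>R g x + u x *\<^sub>R \<eta>' x) \<in> borel_measurable (lebesgue_on U')"
    by (subst lebesgue_on_eq_off_common_part(3)[OF U' I]) (auto simp: 0)
qed

lemma abs_mult_powr_le: "0 \<le> p \<Longrightarrow> \<bar>\<eta> x * a\<bar> powr p \<le> indicator F x * \<bar>a\<bar> powr p"
  using cutoff_eq_0[of x] abs_cutoff_le[of x]
  by (cases "x \<in> F") (auto simp: abs_mult intro!: powr_mono2 mult_left_le_one_le)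

lemma norm_gradient_mult_powr_le:
  assumes "0 \<le> p"
  shows "norm (\<eta> x *\<^sub>R b + a *\<^sub>R \<eta>' x) powr p \<le>
    indicator F x * (2 powr p * (norm b powr p + B powr p * \<bar>a\<bar> powr p))"
  using norm_cutoff_gradient_powr_le[OF abs_cutoff_le[of x] norm_gradient_le[of x] assms, of b a]
  by (cases "x \<in> F") (auto simp: gradient_eq_0 cutoff_eq_0)

lemma integrable_indicator_mult:
  fixes h :: "'a \<Rightarrow> real"
  assumes h: "integrable (lebesgue_on U) h"
    and U: "U \<in> sets lebesgue" and U': "U' \<in> sets lebesgue" and sub: "U' \<inter> F \<subseteq> U"
  shows "integrable (lebesgue_on U') (\<lambda>x. indicator F x * h x)"
    and "(\<And>x. x \<in> U \<Longrightarrow> 0 \<le> h x) \<Longrightarrow>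
      (LINT x|lebesgue_on U'. indicator F x * h x) \<le> integral\<^sup>L (lebesgue_on U) h"
proof -
  have F: "F \<in> sets lebesgue"
    using closed_support by (simp add: borel_closed)
  have i: "integrable (lebesgue_on U) (\<lambda>x. indicator (F \<inter> U') x * h x)"
  proof -
    have "F \<inter> U' \<inter> U \<in> sets (lebesgue_on U)"
      using F U U' by (auto simp: sets_restrict_space)
    from integrable_real_mult_indicator[OF this h] show ?thesis
      by (rule Bochner_Integration.integrable_cong[OF refl, THEN iffD1, rotated])
         (auto simp: indicator_def)
  qed
  have e: "integrable (lebesgue_on U') (\<lambda>x. indicator (F \<inter> U') x * h x) \<longleftrightarrow>
      integrable (lebesgue_on U) (\<lambda>x. indicator (F \<inter> U') x * h x)"
    using sub by (intro lebesgue_on_eq_off_common_part[OF U' U]) (auto simp: indicator_def)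
  show "integrable (lebesgue_on U') (\<lambda>x. indicator F x * h x)"
    using i e by (subst Bochner_Integration.integrable_cong[OF refl,
          of _ _ "\<lambda>x. indicator (F \<inter> U') x * h x"]) (auto simp: indicator_def)
  assume h0: "\<And>x. x \<in> U \<Longrightarrow> 0 \<le> h x"
  have "(LINT x|lebesgue_on U'. indicator F x * h x) = (LINT x|lebesgue_on U'. indicator (F \<inter> U') x * h x)"
    by (intro Bochner_Integration.integral_cong) (auto simp: indicator_def)
  also have "\<dots> = (LINT x|lebesgue_on U. indicator (F \<inter> U') x * h x)"
    using sub by (intro lebesgue_on_eq_off_common_part[OF U' U]) (auto simp: indicator_def)
  also have "\<dots> \<le> integral\<^sup>L (lebesgue_on U) h"
    using i h h0 by (intro integral_mono) (auto simp: indicator_def)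
  finally show "(LINT x|lebesgue_on U'. indicator F x * h x) \<le> integral\<^sup>L (lebesgue_on U) h" .
qed

lemma W1p_mult:
  assumes "(u, g) \<in> W1p p U" and p: "1 \<le> p"
    and U: "U \<in> sets lebesgue" and U': "U' \<in> sets lebesgue" and sub: "U' \<inter> F \<subseteq> U"
  shows "(\<lambda>x. \<eta> x * u x, \<lambda>x. \<eta> x *\<^sub>R g x + u x *\<^sub>R \<eta>' x) \<in> W1p p U'"
proof -
  have u: "Lp_fun p U u" and g: "Lp_fun p U g" and wg: "weak_gradient U u g"
    using assms(1) by (auto simp: W1p_def)
  have m: "u \<in> borel_measurable (lebesgue_on U)" "g \<in> borel_measurable (lebesgue_on U)"
    and i: "integrable (lebesgue_on U) (\<lambda>x. \<bar>u x\<bar> powr p)"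
      "integrable (lebesgue_on U) (\<lambda>x. norm (g x) powr p)"
    using u g by (auto simp: Lp_fun_def)
  have "Lp_fun p U' (\<lambda>x. \<eta> x * u x)"
    using p abs_mult_powr_le
    by (intro Lp_fun_dominated[OF measurable_mult(1)[OF m U U' sub]
          integrable_indicator_mult(1)[OF i(1) U U' sub]]) auto
  moreover have "Lp_fun p U' (\<lambda>x. \<eta> x *\<^sub>R g x + u x *\<^sub>R \<eta>' x)"
    using p i
    by (intro Lp_fun_dominated[OF measurable_mult(2)[OF m U U' sub]
          integrable_indicator_mult(1)[OF _ U U' sub] norm_gradient_mult_powr_le]) auto
  ultimately show ?thesis
    using weak_gradient_mult[OF u g p U U' sub wg] by (simp add: W1p_def)
qed

lemma W1p_tendsto_mult:
  assumes v: "\<And>k. v k \<in> W1p p U" and w: "w \<in> W1p p U" and lim: "W1p_tendsto p U v w" and p: "1 \<le> p"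
    and U: "U \<in> sets lebesgue" and U': "U' \<in> sets lebesgue" and sub: "U' \<inter> F \<subseteq> U"
  shows "W1p_tendsto p U'
    (\<lambda>k. (\<lambda>x. \<eta> x * fst (v k) x, \<lambda>x. \<eta> x *\<^sub>R snd (v k) x + fst (v k) x *\<^sub>R \<eta>' x))
    (\<lambda>x. \<eta> x * fst w x, \<lambda>x. \<eta> x *\<^sub>R snd w x + fst w x *\<^sub>R \<eta>' x)"
proof -
  define a where "a k x = fst (v k) x - fst w x" for k x
  define b where "b k x = snd (v k) x - snd w x" for k x
  have Lp: "Lp_fun p U (a k)" "Lp_fun p U (b k)" for k
    using v[of k] w p unfolding a_def b_def
    by (auto intro!: Lp_fun_diff simp: W1p_def split: prod.splits)
  then have i: "integrable (lebesgue_on U) (\<lambda>x. \<bar>a k x\<bar> powr p)"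
      "integrable (lebesgue_on U) (\<lambda>x. norm (b k x) powr p)" for k
    by (auto simp: Lp_fun_def)
  have l: "(\<lambda>k. LINT x|lebesgue_on U. \<bar>a k x\<bar> powr p) \<longlonglongrightarrow> 0"
      "(\<lambda>k. LINT x|lebesgue_on U. norm (b k x) powr p) \<longlonglongrightarrow> 0"
    using lim by (auto simp: W1p_tendsto_def a_def b_def)
  have p0: "0 \<le> p"
    using p by simp
  let ?h = "\<lambda>k x. 2 powr p * (norm (b k x) powr p + B powr p * \<bar>a k x\<bar> powr p)"
  have "(\<lambda>k. LINT x|lebesgue_on U'. \<bar>\<eta> x * a k x\<bar> powr p) \<longlonglongrightarrow> 0"
  proof (rule tendsto_sandwich[OF _ _ tendsto_const l(1)]; intro always_eventually allI)
    fix k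
    have "(LINT x|lebesgue_on U'. \<bar>\<eta> x * a k x\<bar> powr p) \<le> (LINT x|lebesgue_on U'. indicator F x * \<bar>a k x\<bar> powr p)"
      using abs_mult_powr_le[OF p0]
      by (intro integral_mono' integrable_indicator_mult(1)[OF i(1) U U' sub]) auto
    also have "\<dots> \<le> (LINT x|lebesgue_on U. \<bar>a k x\<bar> powr p)"
      by (intro integrable_indicator_mult(2)[OF i(1) U U' sub]) simp
    finally show "(LINT x|lebesgue_on U'. \<bar>\<eta> x * a k x\<bar> powr p) \<le> (LINT x|lebesgue_on U. \<bar>a k x\<bar> powr p)" .
  qed (auto intro!: integral_nonneg_AE)
  moreover have "(\<lambda>k. LINT x|lebesgue_on U'. norm (\<eta> x *\<^sub>R b k x + a k x *\<^sub>R \<eta>' x) powr p) \<longlonglongrightarrow> 0"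
  proof (rule tendsto_sandwich[OF _ _ tendsto_const]; (intro always_eventually allI)?)
    fix k
    have "(LINT x|lebesgue_on U'. norm (\<eta> x *\<^sub>R b k x + a k x *\<^sub>R \<eta>' x) powr p) \<le>
        (LINT x|lebesgue_on U'. indicator F x * ?h k x)"
      using i by (intro integral_mono' norm_gradient_mult_powr_le[OF p0]
          integrable_indicator_mult(1)[OF _ U U' sub]) auto
    also have "\<dots> \<le> (LINT x|lebesgue_on U. ?h k x)"
      using i by (intro integrable_indicator_mult(2)[OF _ U U' sub]) auto
    also have "\<dots> = 2 powr p * ((LINT x|lebesgue_on U. norm (b k x) powr p) +
        B powr p * (LINT x|lebesgue_on U. \<bar>a k x\<bar> powr p))"
      using i by (simp add: Bochner_Integration.integral_add)
    finally show "(LINT x|lebesgue_on U'. norm (\<eta> x *\<^sub>R b k x + a k x *\<^sub>R \<eta>' x) powr p) \<le> \<dots>" .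
  next
    have "(\<lambda>k. 2 powr p * ((LINT x|lebesgue_on U. norm (b k x) powr p) +
        B powr p * (LINT x|lebesgue_on U. \<bar>a k x\<bar> powr p))) \<longlonglongrightarrow> 2 powr p * (0 + B powr p * 0)"
      by (intro tendsto_intros l)
    then show "(\<lambda>k. 2 powr p * ((LINT x|lebesgue_on U. norm (b k x) powr p) +
        B powr p * (LINT x|lebesgue_on U. \<bar>a k x\<bar> powr p))) \<longlonglongrightarrow> 0"
      by simp
  qed (auto intro!: integral_nonneg_AE)
  ultimately show ?thesis
    by (simp add: W1p_tendsto_def a_def b_def algebra_simps)
qed

text \<open>The approximating sequence is multiplied by \<open>\<eta>\<close> as well. Its members must become continuous on
the closure of \<open>U'\<close>, and \<open>U' \<inter> F \<subseteq> U\<close> says nothing about boundary points of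
\<open>U'\<close> in \<open>F\<close>. The open neighbourhood \<open>G\<close> of \<open>F\<close> gives
\<open>closure U' \<inter> F \<subseteq> closure U\<close>.\<close>
proposition W1p_zero_trace_mult:
  assumes w: "(u, g) \<in> W1p_zero_trace p U \<gamma>" and p: "1 \<le> p"
    and U: "open U" and U': "open U'"
    and G: "open G" "F \<subseteq> G" "U' \<inter> G \<subseteq> U" and \<gamma>: "\<gamma>' \<inter> F \<subseteq> \<gamma>"
  shows "(\<lambda>x. \<eta> x * u x, \<lambda>x. \<eta> x *\<^sub>R g x + u x *\<^sub>R \<eta>' x) \<in> W1p_zero_trace p U' \<gamma>'"
proof -
  have sub: "U' \<inter> F \<subseteq> U"
    using G by auto
  have S: "U \<in> sets lebesgue" "U' \<in> sets lebesgue"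
    using U U' by auto
  obtain v where w1: "(u, g) \<in> W1p p U" and v: "\<And>k. v k \<in> W1p p U"
    and cont: "\<And>k. continuous_on (closure U) (fst (v k))"
    and zero: "\<And>k x. x \<in> \<gamma> \<Longrightarrow> fst (v k) x = 0" and lim: "W1p_tendsto p U v (u, g)"
    using w by (auto simp: W1p_zero_trace_def)
  have clos: "closure U' \<inter> F \<subseteq> closure U"
    using open_Int_closure_subset[OF G(1), of U'] G closure_mono[of "G \<inter> U'" U] by auto
  define v' where "v' = (\<lambda>k. (\<lambda>x. \<eta> x * fst (v k) x, \<lambda>x. \<eta> x *\<^sub>R snd (v k) x + fst (v k) x *\<^sub>R \<eta>' x))"
  have "continuous_on (closure U') (fst (v' k))" for k
  proof -
    \<comment> \<open>glue along the two closed sets \<open>F\<close> and \<open>{\<eta> = 0}\<close>, which cover the space\<close>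
    have "closed {x. \<eta> x = 0}"
      using continuous_closed_vimage[of "{0}" \<eta>] continuous_cutoff[of UNIV]
      by (simp add: continuous_on_eq_continuous_within vimage_def)
    moreover have "continuous_on (closure U' \<inter> F) (\<lambda>x. \<eta> x * fst (v k) x)"
      by (intro continuous_intros continuous_cutoff continuous_on_subset[OF cont clos])
    moreover have "continuous_on (closure U' \<inter> {x. \<eta> x = 0}) (\<lambda>x. \<eta> x * fst (v k) x)"
      by (rule continuous_on_eq[OF continuous_on_const[of _ 0]]) auto
    ultimately have "continuous_on (closure U' \<inter> F \<union> closure U' \<inter> {x. \<eta> x = 0}) (\<lambda>x. \<eta> x * fst (v k) x)"
      using closed_support by (intro continuous_on_closed_Un closed_Int) auto
    moreover have "closure U' \<inter> F \<union> closure U' \<inter> {x. \<eta> x = 0} = closure U'"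
      using cutoff_eq_0 by auto
    ultimately show ?thesis
      by (simp add: v'_def)
  qed
  moreover have "fst (v' k) x = 0" if "x \<in> \<gamma>'" for k x
    using that \<gamma> zero cutoff_eq_0 by (auto simp: v'_def)
  moreover have "v' k \<in> W1p p U'" for k
    using W1p_mult[OF _ p S sub, of "fst (v k)" "snd (v k)"] v by (simp add: v'_def)
  moreover have "W1p_tendsto p U' v' (\<lambda>x. \<eta> x * u x, \<lambda>x. \<eta> x *\<^sub>R g x + u x *\<^sub>R \<eta>' x)"
    using W1p_tendsto_mult[OF v w1 lim p S sub] by (simp add: v'_def)
  ultimately show ?thesis
    using W1p_mult[OF w1 p S sub] unfolding W1p_zero_trace_def by (auto intro!: exI[of _ v'])
qed

end

text \<open>Restriction is the cutoff by the constant one.\<close>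
lemma W1p_zero_trace_subset:
  assumes w: "(u, g) \<in> W1p_zero_trace p U \<gamma>" and p: "1 \<le> p"
    and "open U" "open U'" "U' \<subseteq> U" "\<gamma>' \<subseteq> \<gamma>"
  shows "(u, g) \<in> W1p_zero_trace p U' \<gamma>'"
proof -
  interpret cutoff "\<lambda>_. 1" "\<lambda>_. 0" 0 UNIV
    by unfold_locales (auto simp: GDERIV_const)
  show ?thesis
    using W1p_zero_trace_mult[OF w p, of U' UNIV \<gamma>'] assms by simp
qed

section \<open>Translations\<close>

lemma measurable_lebesgue_add [measurable]:
  fixes b :: "'a::euclidean_space"
  shows "(\<lambda>x. x + b) \<in> measurable lebesgue lebesgue"
proof (rule measurableI)
  fix A :: "'a set" assume A: "A \<in> sets lebesgue"
  have "(\<lambda>x. x + b) -` A \<inter> space lebesgue = (+) (- b) ` A"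
    by (auto simp: image_iff algebra_simps intro!: bexI[of _ "_ + b"])
  then show "(\<lambda>x. x + b) -` A \<inter> space lebesgue \<in> sets lebesgue"
    using lebesgue_sets_translation[OF A, of "- b"] by simp
qed simp

lemma distr_lebesgue_add:
  fixes b :: "'a::euclidean_space"
  shows "distr lebesgue lebesgue (\<lambda>x. x + b) = lebesgue"
proof (rule measure_eqI)
  fix A :: "'a set" assume "A \<in> sets (distr lebesgue lebesgue (\<lambda>x. x + b))"
  then have A: "A \<in> sets lebesgue" by simp
  have "(\<lambda>x. x + b) -` A = (\<lambda>x. 1 *\<^sub>R x + - b) ` A"
    by (auto simp: image_iff algebra_simps intro!: bexI[of _ "_ + b"])
  then show "emeasure (distr lebesgue lebesgue (\<lambda>x. x + b)) A = emeasure lebesgue A"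
    using emeasure_lebesgue_affine[of 1 "- b" A] A by (simp add: emeasure_distr)
qed simp

lemma lebesgue_on_shift:
  fixes f :: "'a::euclidean_space \<Rightarrow> 'b::euclidean_space"
  assumes U: "U \<in> sets lebesgue"
  shows "f \<in> borel_measurable (lebesgue_on U) \<longleftrightarrow>
      (\<lambda>x. f (x + b)) \<in> borel_measurable (lebesgue_on {x. x + b \<in> U})" (is ?M)
    and "integrable (lebesgue_on U) f \<longleftrightarrow>
      integrable (lebesgue_on {x. x + b \<in> U}) (\<lambda>x. f (x + b))" (is ?I)
    and "f \<in> borel_measurable (lebesgue_on U) \<Longrightarrow> integral\<^sup>L (lebesgue_on U) f =
      (LINT x|lebesgue_on {x. x + b \<in> U}. f (x + b))" (is "_ \<Longrightarrow> ?E")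
    and "{x. x + b \<in> U} \<in> sets lebesgue" (is ?S)
proof -
  let ?f = "\<lambda>x. if x \<in> U then f x else 0"
  show S: ?S
    using measurable_sets[OF measurable_lebesgue_add U, of b] by (simp add: vimage_def)
  have f: "(\<lambda>x. if x \<in> {x. x + b \<in> U} then f (x + b) else 0) = (\<lambda>x. ?f (x + b))"
    by auto
  have M1: "(\<lambda>x. h (x + b)) \<in> borel_measurable lebesgue" if "h \<in> borel_measurable lebesgue"
    for h :: "'a \<Rightarrow> 'b" and b
    using measurable_compose[OF measurable_lebesgue_add that] .
  have M: "?f \<in> borel_measurable lebesgue \<longleftrightarrow> (\<lambda>x. ?f (x + b)) \<in> borel_measurable lebesgue"
    using M1[of ?f b] M1[of "\<lambda>x. ?f (x + b)" "- b"] by (simp only: add.assoc left_minus add_0_right) blast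
  then show mm: ?M
    using borel_measurable_if[OF U, of f] borel_measurable_if[OF S, of "\<lambda>x. f (x + b)"] f by simp
  have "integrable lebesgue ?f \<longleftrightarrow> integrable lebesgue (\<lambda>x. ?f (x + b))"
    if "?f \<in> borel_measurable lebesgue"
    using integrable_distr_eq[OF measurable_lebesgue_add that, of b] by (simp add: distr_lebesgue_add)
  then have "integrable lebesgue ?f \<longleftrightarrow> integrable lebesgue (\<lambda>x. ?f (x + b))"
    using M by (metis (no_types, lifting) borel_measurable_integrable)
  then show ?I
    using Lebesgue_Measure.integrable_restrict_UNIV[OF U, of f]
      Lebesgue_Measure.integrable_restrict_UNIV[OF S, of "\<lambda>x. f (x + b)"] f by simp
  assume "f \<in> borel_measurable (lebesgue_on U)"
  then have "integral\<^sup>L lebesgue ?f = integral\<^sup>L lebesgue (\<lambda>x. ?f (x + b))"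
    using integral_distr[OF measurable_lebesgue_add, of ?f b] borel_measurable_if[OF U, of f]
    by (simp add: distr_lebesgue_add)
  then show ?E
    using Lebesgue_Measure.integral_restrict_UNIV[OF U, of f]
      Lebesgue_Measure.integral_restrict_UNIV[OF S, of "\<lambda>x. f (x + b)"] f by simp
qed

lemma Lp_fun_shift:
  fixes f :: "'a::euclidean_space \<Rightarrow> 'b::euclidean_space"
  assumes U: "U \<in> sets lebesgue" and "Lp_fun p U f"
  shows "Lp_fun p {x. x + b \<in> U} (\<lambda>x. f (x + b))"
  using assms lebesgue_on_shift(1)[OF U, of f b]
    lebesgue_on_shift(2)[OF U, of "\<lambda>x. norm (f x) powr p" b] by (simp add: Lp_fun_def)

lemma GDERIV_shift:
  assumes "\<And>x. GDERIV \<phi> x :> \<phi>' x"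
  shows "GDERIV (\<lambda>x. \<phi> (x + b)) x :> \<phi>' (x + b)"
proof -
  have "((\<lambda>x. x + b) has_derivative (\<lambda>h. h)) (at x)"
    by (auto intro!: derivative_eq_intros)
  moreover have "(\<phi> has_derivative (\<lambda>h. inner h (\<phi>' (x + b)))) (at (x + b))"
    using assms by (simp add: gderiv_def)
  ultimately show ?thesis
    unfolding gderiv_def using diff_chain_at[of "\<lambda>x. x + b" "\<lambda>h. h" x \<phi>] by (simp add: o_def)
qed

lemma test_fun_shift:
  assumes "test_fun U \<phi> \<phi>'"
  shows "test_fun {x. x + b \<in> U} (\<lambda>x. \<phi> (x + b)) (\<lambda>x. \<phi>' (x + b))"
proof -
  have \<phi>: "\<And>x. GDERIV \<phi> x :> \<phi>' x" "continuous_on UNIV \<phi>'"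
    using assms by (auto simp: test_fun_def)
  obtain K where K: "compact K" "K \<subseteq> U" "\<And>x. x \<notin> K \<Longrightarrow> \<phi> x = 0"
    using assms by (auto simp: test_fun_def)
  have "compact ((+) (- b) ` K)"
    using K(1) by (rule compact_translation)
  moreover have "(+) (- b) ` K = {x. x + b \<in> K}"
    by (auto simp: image_iff algebra_simps intro!: bexI[of _ "_ + b"])
  moreover have "continuous_on UNIV (\<lambda>x. \<phi>' (x + b))"
    by (rule continuous_on_compose2[OF \<phi>(2)]) (auto intro!: continuous_intros)
  ultimately show ?thesis
    unfolding test_fun_def using K GDERIV_shift[OF \<phi>(1)]
    by (intro conjI allI exI[of _ "{x. x + b \<in> K}"]) auto
qed

lemma weak_gradient_shift:
  assumes U: "U \<in> sets lebesgue" and u: "u \<in> borel_measurable (lebesgue_on U)"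
    and g: "g \<in> borel_measurable (lebesgue_on U)" and wg: "weak_gradient U u g"
  shows "weak_gradient {x. x + b \<in> U} (\<lambda>x. u (x + b)) (\<lambda>x. g (x + b))"
  unfolding weak_gradient_def
proof (intro allI impI)
  fix \<phi> \<phi>' assume t: "test_fun {x. x + b \<in> U} \<phi> \<phi>'"
  define \<psi> where "\<psi> x = \<phi> (x - b)" for x
  define \<psi>' where "\<psi>' x = \<phi>' (x - b)" for x
  have t': "test_fun U \<psi> \<psi>'"
    using test_fun_shift[OF t, of "- b"] by (simp add: \<psi>_def[abs_def] \<psi>'_def[abs_def])
  have "continuous_on UNIV \<psi>" "continuous_on UNIV \<psi>'"
    using t' by (auto simp: test_fun_def intro: GDERIV_imp_continuous_on)
  then have m: "\<psi> \<in> borel_measurable (lebesgue_on U)" "\<psi>' \<in> borel_measurable (lebesgue_on U)"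
    by (auto intro!: measurable_restrict_space1 measurable_completion borel_measurable_continuous_onI)
  have "(LINT x|lebesgue_on U. u x *\<^sub>R \<psi>' x) = - (LINT x|lebesgue_on U. \<psi> x *\<^sub>R g x)"
    using wg t' by (auto simp: weak_gradient_def)
  moreover have "(LINT x|lebesgue_on U. u x *\<^sub>R \<psi>' x) =
      (LINT x|lebesgue_on {x. x + b \<in> U}. u (x + b) *\<^sub>R \<phi>' x)"
    using lebesgue_on_shift(3)[OF U borel_measurable_scaleR[OF u m(2)], of b] by (simp add: \<psi>'_def)
  moreover have "(LINT x|lebesgue_on U. \<psi> x *\<^sub>R g x) =
      (LINT x|lebesgue_on {x. x + b \<in> U}. \<phi> x *\<^sub>R g (x + b))"
    using lebesgue_on_shift(3)[OF U borel_measurable_scaleR[OF m(1) g], of b] by (simp add: \<psi>_def)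
  ultimately show "(LINT x|lebesgue_on {x. x + b \<in> U}. u (x + b) *\<^sub>R \<phi>' x) =
      - (LINT x|lebesgue_on {x. x + b \<in> U}. \<phi> x *\<^sub>R g (x + b))"
    by simp
qed

lemma W1p_shift:
  assumes U: "U \<in> sets lebesgue" and "(u, g) \<in> W1p p U"
  shows "(\<lambda>x. u (x + b), \<lambda>x. g (x + b)) \<in> W1p p {x. x + b \<in> U}"
  using assms Lp_fun_shift[OF U, of p u b] Lp_fun_shift[OF U, of p g b] weak_gradient_shift[OF U, of u g b]
  by (auto simp: W1p_def Lp_fun_def)

lemma W1p_tendsto_shift:
  assumes U: "U \<in> sets lebesgue" and v: "\<And>k. v k \<in> W1p p U" and w: "w \<in> W1p p U"
    and lim: "W1p_tendsto p U v w"
  shows "W1p_tendsto p {x. x + b \<in> U} (\<lambda>k. (\<lambda>x. fst (v k) (x + b), \<lambda>x. snd (v k) (x + b)))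
    (\<lambda>x. fst w (x + b), \<lambda>x. snd w (x + b))"
proof -
  have [measurable]: "fst (v k) \<in> borel_measurable (lebesgue_on U)"
    "snd (v k) \<in> borel_measurable (lebesgue_on U)" "fst w \<in> borel_measurable (lebesgue_on U)"
    "snd w \<in> borel_measurable (lebesgue_on U)" for k
    using v[of k] w by (auto simp: W1p_def Lp_fun_def)
  have "(LINT x|lebesgue_on U. \<bar>fst (v k) x - fst w x\<bar> powr p) =
      (LINT x|lebesgue_on {x. x + b \<in> U}. \<bar>fst (v k) (x + b) - fst w (x + b)\<bar> powr p)" for k
    by (rule lebesgue_on_shift(3)[OF U]) measurable
  moreover have "(LINT x|lebesgue_on U. norm (snd (v k) x - snd w x) powr p) =
      (LINT x|lebesgue_on {x. x + b \<in> U}. norm (snd (v k) (x + b) - snd w (x + b)) powr p)" for k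
    by (rule lebesgue_on_shift(3)[OF U]) measurable
  ultimately show ?thesis
    using lim by (simp add: W1p_tendsto_def)
qed

proposition W1p_zero_trace_shift:
  assumes U: "U \<in> sets lebesgue" and w: "(u, g) \<in> W1p_zero_trace p U \<gamma>"
  shows "(\<lambda>x. u (x + b), \<lambda>x. g (x + b)) \<in> W1p_zero_trace p {x. x + b \<in> U} {x. x + b \<in> \<gamma>}"
proof -
  obtain v where w1: "(u, g) \<in> W1p p U" and v: "\<And>k. v k \<in> W1p p U"
    and cont: "\<And>k. continuous_on (closure U) (fst (v k))"
    and zero: "\<And>k x. x \<in> \<gamma> \<Longrightarrow> fst (v k) x = 0" and lim: "W1p_tendsto p U v (u, g)"
    using w by (auto simp: W1p_zero_trace_def)
  have "{x. x + b \<in> S} = (+) (- b) ` S" for S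
    by (auto simp: image_iff algebra_simps intro!: bexI[of _ "_ + b"])
  then have clos: "closure {x. x + b \<in> U} = {x. x + b \<in> closure U}"
    using closure_translation[of "- b" U] by simp
  define v' where "v' = (\<lambda>k. (\<lambda>x. fst (v k) (x + b), \<lambda>x. snd (v k) (x + b)))"
  have "continuous_on (closure {x. x + b \<in> U}) (fst (v' k))" for k
    unfolding v'_def fst_conv
    by (rule continuous_on_compose2[OF cont]) (auto intro!: continuous_intros simp: clos)
  moreover have "v' k \<in> W1p p {x. x + b \<in> U}" for k
    using W1p_shift[OF U, of "fst (v k)" "snd (v k)" p b] v by (simp add: v'_def)
  moreover have "fst (v' k) x = 0" if "x + b \<in> \<gamma>" for k x
    using zero that by (simp add: v'_def)
  moreover have "W1p_tendsto p {x. x + b \<in> U} v' (\<lambda>x. u (x + b), \<lambda>x. g (x + b))"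
    using W1p_tendsto_shift[OF U v w1 lim, of b] by (simp add: v'_def)
  ultimately show ?thesis
    using W1p_shift[OF U w1, of b] unfolding W1p_zero_trace_def by (auto intro!: exI[of _ v'])
qed

section \<open>Null sets and measurability over the cross-section\<close>

lemma cylinder_iff: "x \<in> cylinder I S \<longleftrightarrow> x $ None \<in> I \<and> tail x \<in> S"
  by (simp add: cylinder_def)

lemma continuous_on_tail: "continuous_on S tail"
  unfolding tail_def by (intro continuous_intros)

lemma measurable_tail [measurable]: "tail \<in> borel_measurable borel"
  by (rule borel_measurable_continuous_onI[OF continuous_on_tail])

lemma measurable_axial [measurable]: "(\<lambda>x :: real ^ 'n. x $ i) \<in> borel_measurable borel"
  by (intro borel_measurable_continuous_onI continuous_intros)

lemma open_cylinder:
  assumes "open I" "open S"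
  shows "open (cylinder I S)"
proof -
  have "cylinder I S = (\<lambda>x. x $ None) -` I \<inter> tail -` S"
    by (auto simp: cylinder_def)
  then show ?thesis
    using assms by (simp add: open_Int open_vimage continuous_on_tail continuous_intros)
qed

lemma prod_Basis_vec: "(\<Prod>b\<in>(Basis :: (real ^ 'n) set). f b) = (\<Prod>i\<in>UNIV. f (axis i 1))"
proof -
  have "inj (\<lambda>i :: 'n. axis i (1 :: real))"
    by (auto simp: inj_def axis_eq_axis)
  moreover have "(Basis :: (real ^ 'n) set) = range (\<lambda>i. axis i 1)"
    by (auto simp: Basis_vec_def)
  ultimately show ?thesis
    by (metis (no_types, lifting) prod.reindex_cong)
qed

text \<open>A slab of thickness one projects Lebesgue measure onto Lebesgue measure, as one sees on boxes.
This is the case of Fubini's theorem needed for \<open>null_sets_tail_vimage\<close>; the full space would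
give an infinite multiple.\<close>
lemma distr_unit_slab_tail:
  "distr (restrict_space lborel {x :: real ^ ('m::finite option). a < x $ None \<and> x $ None < a + 1}) borel tail
    = lborel"
proof (rule lborel_eqI[symmetric])
  fix l u :: "real ^ 'm" assume lu: "\<And>b. b \<in> Basis \<Longrightarrow> l \<bullet> b \<le> u \<bullet> b"
  let ?S = "{x :: real ^ ('m option). a < x $ None \<and> x $ None < a + 1}"
  define l' :: "real ^ ('m option)" where "l' = (\<chi> i. case i of None \<Rightarrow> a | Some j \<Rightarrow> l $ j)"
  define u' :: "real ^ ('m option)" where "u' = (\<chi> i. case i of None \<Rightarrow> a + 1 | Some j \<Rightarrow> u $ j)"
  have lu': "l $ i \<le> u $ i" for i
    using lu[of "axis i 1"] by (simp add: inner_axis)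
  have le: "l' \<bullet> b \<le> u' \<bullet> b" if "b \<in> Basis" for b
    using that lu' by (auto simp: Basis_vec_def inner_axis l'_def u'_def split: option.split)
  have S: "?S \<in> sets lborel"
    by simp
  have box: "tail -` box l u \<inter> ?S = box l' u'"
    by (auto simp: mem_box_cart tail_def l'_def u'_def split_option_all)
  have "emeasure (distr (restrict_space lborel ?S) borel tail) (box l u) =
      emeasure (restrict_space lborel ?S) (tail -` box l u \<inter> ?S)"
    by (subst emeasure_distr) (auto simp: space_restrict_space intro: measurable_restrict_space1)
  also have "\<dots> = emeasure lborel (box l' u')"
    using S box by (subst emeasure_restrict_space) auto
  also have "\<dots> = (\<Prod>i\<in>UNIV. u' $ i - l' $ i)"
    by (simp add: emeasure_lborel_box[OF le] prod_Basis_vec inner_axis)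
  also have "(\<Prod>i\<in>UNIV. u' $ i - l' $ i) = (\<Prod>i\<in>UNIV. u $ i - l $ i)"
    by (simp add: UNIV_option_conv prod.reindex l'_def u'_def)
  also have "\<dots> = (\<Prod>b\<in>Basis. (u - l) \<bullet> b)"
    by (simp add: prod_Basis_vec inner_axis)
  finally show "emeasure (distr (restrict_space lborel ?S) borel tail) (box l u) =
      ennreal (\<Prod>b\<in>Basis. (u - l) \<bullet> b)" .
qed simp

text \<open>A projection need not be measurable for the completed measures unless preimages of null sets are
null. Here the whole preimage is covered by countably many slabs of thickness one.\<close>
lemma null_sets_tail_vimage:
  fixes N :: "(real ^ 'm::finite) set"
  assumes "N \<in> null_sets lebesgue"
  shows "tail -` N \<in> null_sets lebesgue"
proof -
  obtain N' where N': "N \<subseteq> N'" "N' \<in> null_sets lborel"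
    using assms by (auto simp: null_sets_completion_iff2)
  let ?S = "\<lambda>a. {x :: real ^ ('m option). a < x $ None \<and> x $ None < a + 1}"
  have [measurable]: "N' \<in> sets borel"
    using N' by auto
  have *: "tail -` N' \<inter> ?S a \<in> null_sets lborel" for a
  proof -
    have "emeasure (distr (restrict_space lborel (?S a)) borel tail) N' = 0"
      using N' by (simp add: distr_unit_slab_tail null_setsD1)
    moreover have "emeasure (distr (restrict_space lborel (?S a)) borel tail) N' =
        emeasure (restrict_space lborel (?S a)) (tail -` N' \<inter> ?S a)"
      by (subst emeasure_distr) (auto simp: space_restrict_space intro: measurable_restrict_space1)
    moreover have "emeasure (restrict_space lborel (?S a)) (tail -` N' \<inter> ?S a) =
        emeasure lborel (tail -` N' \<inter> ?S a)"
      by (rule emeasure_restrict_space) auto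
    moreover have "tail -` N' \<inter> ?S a \<in> sets borel"
      using measurable_sets[OF measurable_tail, of N'] by (intro sets.Int) auto
    ultimately show ?thesis
      by (simp add: null_sets_def)
  qed
  have "(\<Union>a\<in>\<rat>. tail -` N' \<inter> ?S a) \<in> null_sets lborel"
    by (rule null_sets_UN'[OF countable_rat]) (rule *)
  moreover have "tail -` N' = (\<Union>a\<in>\<rat>. tail -` N' \<inter> ?S a)"
  proof -
    have "\<exists>a\<in>\<rat>. a < t \<and> t < a + 1" for t :: real
      using Rats_dense_in_real[of "t - 1" t] by force
    then show ?thesis
      by fast
  qed
  ultimately have "tail -` N' \<in> null_sets lebesgue"
    by (metis null_sets_completionI)
  then show ?thesis
    by (rule null_sets_completion_subset[rotated]) (use N' in auto)
qed

lemma AE_tail: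
  fixes S :: "(real ^ 'm::finite) set"
  assumes "AE X in lebesgue_on S. P X" "open S" "open I"
  shows "AE x in lebesgue_on (cylinder I S). P (tail x)"
proof -
  have "AE X in lebesgue. X \<in> S \<longrightarrow> P X"
    using assms by (subst (asm) AE_restrict_space_iff) auto
  then obtain N where N: "N \<in> null_sets lebesgue" "{X. \<not> (X \<in> S \<longrightarrow> P X)} \<subseteq> N"
    by (auto elim: AE_E3 simp: eventually_ae_filter)
  have "AE x in lebesgue. tail x \<in> S \<longrightarrow> P (tail x)"
    by (rule AE_I'[OF null_sets_tail_vimage[OF N(1)]]) (use N(2) in auto)
  then show ?thesis
    using open_cylinder[OF assms(3,2)] by (subst AE_restrict_space_iff) (auto simp: cylinder_iff)
qed

lemma measurable_tail_compose:
  fixes f :: "real ^ 'm::finite \<Rightarrow> real"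
  assumes f: "f \<in> borel_measurable (lebesgue_on S)" and S: "open S" and I: "open I"
  shows "(\<lambda>x. f (tail x)) \<in> borel_measurable (lebesgue_on (cylinder I S))"
proof -
  have cyl: "cylinder I S \<in> sets lebesgue"
    using open_cylinder[OF I S] by auto
  have "(\<lambda>X. if X \<in> S then f X else 0) \<in> borel_measurable lebesgue"
    using f S by (intro borel_measurable_if_I) auto
  then obtain f' where f': "f' \<in> borel_measurable lborel" "AE X in lborel. (if X \<in> S then f X else 0) = f' X"
    using completion_ex_borel_measurable_real[of "\<lambda>X. if X \<in> S then f X else 0" lborel] by auto
  have "AE X in lebesgue. (if X \<in> S then f X else 0) = f' X"
    using f'(2) by (rule AE_completion)
  then have "AE X in lebesgue_on S. f X = f' X"
    using S by (subst AE_restrict_space_iff) auto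
  from AE_tail[OF this S I] have ae: "AE x in lebesgue_on (cylinder I S). f (tail x) = f' (tail x)" .
  have "(\<lambda>x. f' (tail x)) \<in> borel_measurable borel"
    using f'(1) by measurable
  then have "(\<lambda>x. f' (tail x)) \<in> borel_measurable (lebesgue_on (cylinder I S))"
    by (intro measurable_restrict_space1 measurable_completion) simp
  then have "(\<lambda>x. if x \<in> cylinder I S then f' (tail x) else 0) \<in> borel_measurable lebesgue"
    using cyl by (intro borel_measurable_if_I)
  moreover have "AE x in lebesgue. (if x \<in> cylinder I S then f' (tail x) else 0) =
      (if x \<in> cylinder I S then f (tail x) else 0)"
    using ae cyl by (subst (asm) AE_restrict_space_iff) auto
  ultimately have "(\<lambda>x. if x \<in> cylinder I S then f (tail x) else 0) \<in> borel_measurable lebesgue"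
    by (rule borel_measurable_AE)
  then show ?thesis
    by (rule borel_measurable_if_D)
qed

section \<open>Axial cutoffs and translations on cylinders\<close>

text \<open>A \<open>C\<^sup>1\<close> step: zero for \<open>t \<le> 0\<close>, one for \<open>t \<ge> 1\<close>, a parabola on each half of
the unit interval. As a combination of shifts of the \<open>C\<^sup>1\<close> function
\<open>t \<mapsto> (max 0 t)\<^sup>2\<close> it is \<open>C\<^sup>1\<close> across the breakpoints.\<close>
definition ramp :: "real \<Rightarrow> real" where
  "ramp t = 2 * (max 0 t)\<^sup>2 - 4 * (max 0 (t - 1/2))\<^sup>2 + 2 * (max 0 (t - 1))\<^sup>2"

definition ramp' :: "real \<Rightarrow> real" where
  "ramp' t = 4 * max 0 t - 8 * max 0 (t - 1/2) + 4 * max 0 (t - 1)"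

lemma DERIV_max_power2: "((\<lambda>t. (max 0 t)\<^sup>2) has_real_derivative 2 * max 0 t) (at t)"
proof -
  consider "t < 0" | "t > 0" | "t = 0" by linarith
  then show ?thesis
  proof cases
    case 1
    have "((\<lambda>t. 0) has_real_derivative 2 * max 0 t) (at t)"
      using 1 by simp
    then show ?thesis
      by (rule has_field_derivative_transform_within_open[of _ _ _ "{..<0}"]) (use 1 in auto)
  next
    case 2
    have "((\<lambda>t. t\<^sup>2) has_real_derivative 2 * max 0 t) (at t)"
      using 2 by (auto intro!: derivative_eq_intros)
    then show ?thesis
      by (rule has_field_derivative_transform_within_open[of _ _ _ "{0<..}"]) (use 2 in auto)
  next
    case 3
    have "((\<lambda>h :: real. max 0 h) \<longlongrightarrow> 0) (at 0)"
      using tendsto_max[OF tendsto_const[of 0] tendsto_ident_at[of 0 UNIV]] by simp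
    then have "((\<lambda>h :: real. (max 0 h)\<^sup>2 / h) \<longlongrightarrow> 0) (at 0)"
      by (rule Lim_transform_eventually)
        (auto simp: eventually_at_filter max_def power2_eq_square)
    then show ?thesis
      using 3 by (simp add: DERIV_def)
  qed
qed

lemma DERIV_ramp: "(ramp has_real_derivative ramp' t) (at t)"
proof -
  have sh: "((\<lambda>t. (max 0 (t - c))\<^sup>2) has_real_derivative 2 * max 0 (t - c)) (at t)" for c
    using DERIV_shift[of "\<lambda>t. (max 0 t)\<^sup>2" "2 * max 0 (t - c)" t "- c"] DERIV_max_power2[of "t - c"]
    by simp
  show ?thesis
    unfolding ramp_def ramp'_def
    by (rule derivative_eq_intros DERIV_max_power2 sh refl | simp)+
qed

lemma continuous_on_ramp': "continuous_on S ramp'"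
  unfolding ramp'_def by (intro continuous_intros)

lemma ramp_eq_0: "t \<le> 0 \<Longrightarrow> ramp t = 0"
  by (simp add: ramp_def max_def)

text \<open>The symmetry that makes \<open>ramp t\<close> and \<open>ramp (1 - t)\<close> a partition of unity; it also reduces
statements about large \<open>t\<close> to small \<open>t\<close>.\<close>
lemma ramp_complement: "ramp (1 - t) = 1 - ramp t"
proof -
  consider "t \<le> 0" | "0 \<le> t \<and> t \<le> 1/2" | "1/2 \<le> t \<and> t \<le> 1" | "1 \<le> t" by linarith
  then show ?thesis
    by cases (auto simp: ramp_def max_def power2_eq_square algebra_simps)
qed

lemma ramp_eq_1: "1 \<le> t \<Longrightarrow> ramp t = 1"
  using ramp_complement[of "1 - t"] ramp_eq_0[of "1 - t"] by simp

lemma ramp_nonneg: "0 \<le> ramp t"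
proof -
  have low: "0 \<le> ramp t \<and> ramp t \<le> 1" if "t \<le> 1/2" for t
  proof (cases "t \<le> 0")
    case False
    then have "ramp t = 2 * t\<^sup>2" "t\<^sup>2 \<le> (1/2)\<^sup>2"
      using that by (auto simp: ramp_def max_def intro!: power_mono)
    then show ?thesis
      by (simp add: power2_eq_square)
  qed (simp add: ramp_eq_0)
  show ?thesis
    using low[of t] low[of "1 - t"] ramp_complement[of t] by (cases "t \<le> 1/2") auto
qed

lemma ramp_le_1: "ramp t \<le> 1"
  using ramp_nonneg[of "1 - t"] ramp_complement[of t] by simp

lemma abs_ramp'_le: "\<bar>ramp' t\<bar> \<le> 2"
  by (auto simp: ramp'_def max_def)

lemma ramp'_eq_0: "t \<le> 0 \<or> 1 \<le> t \<Longrightarrow> ramp' t = 0"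
  by (auto simp: ramp'_def max_def)

lemma cutoff_ramp:
  "cutoff (\<lambda>x :: real ^ 'n::finite. ramp (s * x $ i + t)) (\<lambda>x. (s * ramp' (s * x $ i + t)) *\<^sub>R axis i 1)
    (2 * \<bar>s\<bar>) {x. 0 \<le> s * x $ i + t}"
proof
  fix x :: "real ^ 'n"
  have "((\<lambda>x. s * x $ i + t) has_derivative (\<lambda>h. s * h $ i)) (at x)"
    by (auto intro!: derivative_eq_intros bounded_linear.has_derivative[OF bounded_linear_vec_nth])
  then have "GDERIV (\<lambda>x. s * x $ i + t) x :> s *\<^sub>R axis i 1"
    by (simp add: gderiv_def inner_axis mult.commute)
  from GDERIV_DERIV_compose[OF this DERIV_ramp]
  show "GDERIV (\<lambda>x. ramp (s * x $ i + t)) x :> (s * ramp' (s * x $ i + t)) *\<^sub>R axis i 1"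
    by (simp add: mult.commute)
  show "\<bar>ramp (s * x $ i + t)\<bar> \<le> 1"
    using ramp_nonneg[of "s * x $ i + t"] ramp_le_1[of "s * x $ i + t"] by linarith
  show "norm ((s * ramp' (s * x $ i + t)) *\<^sub>R axis i (1 :: real)) \<le> 2 * \<bar>s\<bar>"
    using mult_left_mono[OF abs_ramp'_le[of "s * x $ i + t"], of "\<bar>s\<bar>"] by (simp add: abs_mult)
  show "x \<notin> {x. 0 \<le> s * x $ i + t} \<Longrightarrow> ramp (s * x $ i + t) = 0"
    by (simp add: ramp_eq_0)
next
  show "continuous_on UNIV (\<lambda>x :: real ^ 'n. (s * ramp' (s * x $ i + t)) *\<^sub>R axis i (1 :: real))"
    by (intro continuous_intros continuous_on_compose2[OF continuous_on_ramp'[of UNIV]]) auto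
  show "closed {x :: real ^ 'n. 0 \<le> s * x $ i + t}"
    by (intro closed_Collect_le continuous_intros)
qed

text \<open>The ramp vanishes where \<open>s r + t \<le> 0\<close>. The margin \<open>\<epsilon>\<close> keeps its support away from the
ends of \<open>I\<close> that are interior to \<open>J\<close>. At a common end of \<open>I\<close> and \<open>J\<close> the
function keeps its values, in accordance with the natural boundary condition there.\<close>
lemma V_space_ramp:
  fixes \<omega> :: "(real ^ 'm::finite) set"
  assumes w: "(u, g) \<in> V_space p \<omega> I" and p: "1 \<le> p" and "open \<omega>" "open I" "open J"
    and \<epsilon>: "0 < \<epsilon>" and J: "\<And>r. r \<in> J \<Longrightarrow> - \<epsilon> < s * r + t \<Longrightarrow> r \<in> I"
  shows "(\<lambda>x. ramp (s * x $ None + t) * u x,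
      \<lambda>x. ramp (s * x $ None + t) *\<^sub>R g x + u x *\<^sub>R (s * ramp' (s * x $ None + t)) *\<^sub>R axis None 1)
    \<in> V_space p \<omega> J"
proof -
  interpret cutoff "\<lambda>x :: real ^ ('m option). ramp (s * x $ None + t)"
    "\<lambda>x. (s * ramp' (s * x $ None + t)) *\<^sub>R axis None 1" "2 * \<bar>s\<bar>" "{x. 0 \<le> s * x $ None + t}"
    by (rule cutoff_ramp)
  have "open {x :: real ^ ('m option). - \<epsilon> < s * x $ None + t}"
    by (intro open_Collect_less continuous_intros)
  then show ?thesis
    unfolding V_space_def
    using open_cylinder[OF \<open>open I\<close> \<open>open \<omega>\<close>] open_cylinder[OF \<open>open J\<close> \<open>open \<omega>\<close>] \<epsilon> J
    by (intro W1p_zero_trace_mult[OF w[unfolded V_space_def] p, where G = "{x. - \<epsilon> < s * x $ None + t}"])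
      (auto simp: cylinder_def)
qed

lemma V_space_subset:
  assumes "(u, g) \<in> V_space p \<omega> I" "1 \<le> p" "open \<omega>" "open I" "open J" "J \<subseteq> I"
  shows "(u, g) \<in> V_space p \<omega> J"
  unfolding V_space_def
  by (rule W1p_zero_trace_subset[OF assms(1)[unfolded V_space_def] assms(2)])
    (use assms in \<open>auto simp: open_cylinder cylinder_iff\<close>)

lemma tail_add_axis: "tail (x + axis None c) = tail x"
  by (simp add: tail_def axis_def)

lemma cylinder_shift: "{x. x + axis None c \<in> cylinder I S} = cylinder {r. r + c \<in> I} S"
  by (auto simp: cylinder_def tail_add_axis)

lemma V_space_shift:
  assumes "(u, g) \<in> V_space p \<omega> I" "open \<omega>" "open I"
  shows "(\<lambda>x. u (x + axis None c), \<lambda>x. g (x + axis None c)) \<in> V_space p \<omega> {r. r + c \<in> I}"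
proof -
  have "cylinder I \<omega> \<in> sets lebesgue"
    using open_cylinder[OF assms(3,2)] by auto
  from W1p_zero_trace_shift[OF this assms(1)[unfolded V_space_def], of "axis None c"] show ?thesis
    by (simp add: V_space_def cylinder_shift)
qed

section \<open>Energy, mass and Rayleigh quotients on a cylinder\<close>

locale elliptic_cylinder =
  fixes \<omega> :: "(real ^ 'm::finite) set"
    and A :: "real ^ 'm \<Rightarrow> real ^ ('m option) ^ ('m option)"
    and C lam p :: real
  assumes open_section: "open \<omega>"
    and measurable_A: "\<And>i j. (\<lambda>X. A X $ i $ j) \<in> borel_measurable (lebesgue_on \<omega>)"
    and C_pos: "C > 0" and lam_pos: "lam > 0"
    and onorm_A_le: "AE X in lebesgue_on \<omega>. onorm (\<lambda>\<xi>. A X *v \<xi>) \<le> C"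
    and A_coercive: "AE X in lebesgue_on \<omega>. \<forall>\<xi>. (A X *v \<xi>) \<bullet> \<xi> \<ge> lam * (norm \<xi>)\<^sup>2"
    and p_ge_1: "p \<ge> 1"
begin

definition energy_density :: "(real ^ ('m option) \<Rightarrow> real ^ ('m option)) \<Rightarrow> real ^ ('m option) \<Rightarrow> real" where
  "energy_density g x = \<bar>(A (tail x) *v g x) \<bullet> g x\<bar> powr (p / 2)"

definition energy :: "real set \<Rightarrow> (real ^ ('m option) \<Rightarrow> real ^ ('m option)) \<Rightarrow> real" where
  "energy I g = (LINT x|lebesgue_on (cylinder I \<omega>). energy_density g x)"

definition mass :: "real set \<Rightarrow> (real ^ ('m option) \<Rightarrow> real) \<Rightarrow> real" where
  "mass I u = (LINT x|lebesgue_on (cylinder I \<omega>). \<bar>u x\<bar> powr p)"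

definition rayleigh_quotients :: "real set \<Rightarrow> real set" where
  "rayleigh_quotients I = {energy I g / mass I u | u g. (u, g) \<in> V_space p \<omega> I \<and> mass I u \<noteq> 0}"

lemma cylinder_sets: "open I \<Longrightarrow> cylinder I \<omega> \<in> sets lebesgue"
  using open_cylinder[OF _ open_section] by auto

lemma V_spaceD:
  assumes "(u, g) \<in> V_space p \<omega> I"
  shows "u \<in> borel_measurable (lebesgue_on (cylinder I \<omega>))"
    and "g \<in> borel_measurable (lebesgue_on (cylinder I \<omega>))"
    and "integrable (lebesgue_on (cylinder I \<omega>)) (\<lambda>x. \<bar>u x\<bar> powr p)"
    and "integrable (lebesgue_on (cylinder I \<omega>)) (\<lambda>x. norm (g x) powr p)"
  using assms by (auto simp: V_space_def W1p_zero_trace_def W1p_def Lp_fun_def)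

lemma mass_nonneg: "0 \<le> mass I u" and energy_nonneg: "0 \<le> energy I g"
  unfolding mass_def energy_def energy_density_def by (auto intro!: integral_nonneg_AE)

lemma mass_eq_0_iff:
  assumes "(u, g) \<in> V_space p \<omega> I"
  shows "mass I u = 0 \<longleftrightarrow> (AE x in lebesgue_on (cylinder I \<omega>). u x = 0)"
  unfolding mass_def using integral_nonneg_eq_0_iff_AE[OF V_spaceD(3)[OF assms]] by simp

lemma inf_rayleigh_eq: "inf_rayleigh p A \<omega> I = Inf (rayleigh_quotients I)"
proof -
  have "{rayleigh p A (cylinder I \<omega>) u g | u g.
      (u, g) \<in> V_space p \<omega> I \<and> \<not> (AE x in lebesgue_on (cylinder I \<omega>). u x = 0)} = rayleigh_quotients I"
    unfolding rayleigh_quotients_def rayleigh_def mass_def[symmetric] energy_density_def[symmetric]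
      energy_def[symmetric] using mass_eq_0_iff by fast
  then show ?thesis
    by (simp add: inf_rayleigh_def)
qed

lemma measurable_energy_density:
  assumes [measurable]: "g \<in> borel_measurable (lebesgue_on (cylinder I \<omega>))" and I: "open I"
  shows "energy_density g \<in> borel_measurable (lebesgue_on (cylinder I \<omega>))"
proof -
  have [measurable]: "(\<lambda>x. A (tail x) $ i $ j) \<in> borel_measurable (lebesgue_on (cylinder I \<omega>))" for i j
    by (rule measurable_tail_compose[OF measurable_A open_section I])
  have [measurable]: "(\<lambda>x. g x $ i) \<in> borel_measurable (lebesgue_on (cylinder I \<omega>))" for i
    using measurable_compose[OF assms(1) measurable_axial] .
  show ?thesis
    unfolding energy_density_def[abs_def] inner_vec_def matrix_vector_mult_def by simp
qed

lemma AE_energy_bounds: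
  assumes I: "open I"
  shows "AE x in lebesgue_on (cylinder I \<omega>). \<forall>g. energy_density g x \<le> C powr (p / 2) * norm (g x) powr p \<and>
    lam powr (p / 2) * norm (g x) powr p \<le> energy_density g x"
proof -
  have square: "(norm \<xi>)\<^sup>2 powr (p / 2) = norm \<xi> powr p" for \<xi> :: "real ^ ('m option)"
    by (cases "\<xi> = 0") (simp_all add: powr_powr flip: powr_numeral)
  have bound: "\<bar>(M *v \<xi>) \<bullet> \<xi>\<bar> powr (p / 2) \<le> C powr (p / 2) * norm \<xi> powr p"
    if "onorm (\<lambda>\<xi>. M *v \<xi>) \<le> C" for M :: "real ^ ('m option) ^ ('m option)" and \<xi>
  proof -
    have "\<bar>(M *v \<xi>) \<bullet> \<xi>\<bar> \<le> norm (M *v \<xi>) * norm \<xi>"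
      by (rule Cauchy_Schwarz_ineq2)
    also have "\<dots> \<le> onorm (\<lambda>\<xi>. M *v \<xi>) * norm \<xi> * norm \<xi>"
      by (intro mult_right_mono onorm matrix_vector_mul_bounded_linear) auto
    also have "\<dots> \<le> C * (norm \<xi>)\<^sup>2"
      using mult_right_mono[OF that, of "norm \<xi> * norm \<xi>"] by (simp add: power2_eq_square mult.assoc)
    finally have "\<bar>(M *v \<xi>) \<bullet> \<xi>\<bar> powr (p / 2) \<le> (C * (norm \<xi>)\<^sup>2) powr (p / 2)"
      using p_ge_1 by (intro powr_mono2) auto
    also have "\<dots> = C powr (p / 2) * norm \<xi> powr p"
      using C_pos by (simp add: powr_mult square)
    finally show ?thesis .
  qed
  have coercive: "lam powr (p / 2) * norm \<xi> powr p \<le> \<bar>(M *v \<xi>) \<bullet> \<xi>\<bar> powr (p / 2)"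
    if "\<forall>\<xi>. (M *v \<xi>) \<bullet> \<xi> \<ge> lam * (norm \<xi>)\<^sup>2" for M :: "real ^ ('m option) ^ ('m option)" and \<xi>
  proof -
    have "lam powr (p / 2) * norm \<xi> powr p = (lam * (norm \<xi>)\<^sup>2) powr (p / 2)"
      using lam_pos by (simp add: powr_mult square)
    also have "\<dots> \<le> \<bar>(M *v \<xi>) \<bullet> \<xi>\<bar> powr (p / 2)"
      using that p_ge_1 lam_pos by (intro powr_mono2) (auto intro: order_trans[OF _ abs_ge_self])
    finally show ?thesis .
  qed
  show ?thesis
    using AE_tail[OF onorm_A_le open_section I] AE_tail[OF A_coercive open_section I]
    unfolding energy_density_def by eventually_elim (use bound coercive in blast)
qed

lemma integrable_energy_density:
  assumes V: "(u, g) \<in> V_space p \<omega> I" and I: "open I"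
  shows "integrable (lebesgue_on (cylinder I \<omega>)) (energy_density g)"
proof (rule Bochner_Integration.integrable_bound)
  show "integrable (lebesgue_on (cylinder I \<omega>)) (\<lambda>x. C powr (p / 2) * norm (g x) powr p)"
    using V_spaceD(4)[OF V] by simp
  show "AE x in lebesgue_on (cylinder I \<omega>). norm (energy_density g x) \<le>
      norm (C powr (p / 2) * norm (g x) powr p)"
    using AE_energy_bounds[OF I] by eventually_elim (auto simp: energy_density_def)
qed (rule measurable_energy_density[OF V_spaceD(2)[OF V] I])

lemma bdd_below_rayleigh_quotients: "bdd_below (rayleigh_quotients I)"
  by (rule bdd_belowI[of _ 0]) (auto simp: rayleigh_quotients_def mass_nonneg energy_nonneg)

lemma inf_rayleigh_nonneg: "rayleigh_quotients I \<noteq> {} \<Longrightarrow> 0 \<le> inf_rayleigh p A \<omega> I"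
  unfolding inf_rayleigh_eq
  by (rule cInf_greatest) (auto simp: rayleigh_quotients_def mass_nonneg energy_nonneg)

text \<open>Multiplied out, the bound also holds for functions of zero mass, so the two parts of a split
function need not be checked for being nonzero.\<close>
lemma inf_rayleigh_mult_mass_le:
  assumes "(u, g) \<in> V_space p \<omega> I"
  shows "inf_rayleigh p A \<omega> I * mass I u \<le> energy I g"
proof (cases "mass I u = 0")
  case False
  then have "energy I g / mass I u \<in> rayleigh_quotients I"
    using assms by (auto simp: rayleigh_quotients_def)
  then have "inf_rayleigh p A \<omega> I \<le> energy I g / mass I u"
    unfolding inf_rayleigh_eq by (rule cInf_lower[OF _ bdd_below_rayleigh_quotients])
  then show ?thesis
    using False mass_nonneg[of I u] by (simp add: field_simps)
qed (simp add: energy_nonneg)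

lemma rayleigh_quotients_shift:
  assumes I: "open I"
  shows "rayleigh_quotients {r. r + c \<in> I} = rayleigh_quotients I"
proof -
  have sub: "rayleigh_quotients I \<subseteq> rayleigh_quotients {r. r + c \<in> I}" if I: "open I" for I c
  proof
    fix r assume "r \<in> rayleigh_quotients I"
    then obtain u g where V: "(u, g) \<in> V_space p \<omega> I" "mass I u \<noteq> 0" and r: "r = energy I g / mass I u"
      by (auto simp: rayleigh_quotients_def)
    note [measurable] = V_spaceD(1,2)[OF V(1)]
    have "energy I g = energy {r. r + c \<in> I} (\<lambda>x. g (x + axis None c))"
      using lebesgue_on_shift(3)[OF cylinder_sets[OF I] measurable_energy_density[OF V_spaceD(2)[OF V(1)] I],
          of "axis None c"]
      by (simp add: energy_def cylinder_shift energy_density_def[abs_def] tail_add_axis)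
    moreover have "mass I u = mass {r. r + c \<in> I} (\<lambda>x. u (x + axis None c))"
      using lebesgue_on_shift(3)[OF cylinder_sets[OF I], of "\<lambda>x. \<bar>u x\<bar> powr p" "axis None c"]
      by (simp add: mass_def cylinder_shift)
    ultimately show "r \<in> rayleigh_quotients {r. r + c \<in> I}"
      using V_space_shift[OF V(1) open_section I, of c] V(2) r by (auto simp: rayleigh_quotients_def)
  qed
  have "open {r. r + c \<in> I}"
    using open_vimage[OF I, of "\<lambda>r. r + c"] by (simp add: vimage_def continuous_intros)
  from sub[OF I, of c] sub[OF this, of "- c"] show ?thesis
    by auto
qed

text \<open>A competitor on \<open>I\<close> is restricted to \<open>J l\<close>: the energy does not grow and the mass converges
by dominated convergence. The conclusion is stated for quotients rather than infima because it is also
the source of competitors on \<open>J l\<close> for large \<open>l\<close>.\<close>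
lemma rayleigh_quotients_exhaustion:
  assumes I: "open I" and J: "\<And>l. open (J l)" "\<And>l. J l \<subseteq> I"
    and exh: "\<And>r. r \<in> I \<Longrightarrow> \<forall>\<^sub>F l :: real in at_top. r \<in> J l"
    and q: "q \<in> rayleigh_quotients I" and y: "q < y"
  shows "\<forall>\<^sub>F l in at_top. \<exists>q' \<in> rayleigh_quotients (J l). q' < y"
proof -
  let ?M = "lebesgue_on (cylinder I \<omega>)"
  obtain u g where V: "(u, g) \<in> V_space p \<omega> I" "mass I u \<noteq> 0" and q: "q = energy I g / mass I u"
    using q by (auto simp: rayleigh_quotients_def)
  have pos: "0 < mass I u"
    using V(2) mass_nonneg[of I u] by simp
  note S = cylinder_sets[OF I] cylinder_sets[OF J(1)]
  have sub: "cylinder (J l) \<omega> \<subseteq> cylinder I \<omega>" for l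
    using J(2)[of l] by (auto simp: cylinder_iff)
  have restrict: "integral\<^sup>L (lebesgue_on (cylinder (J l) \<omega>)) f =
      (LINT x|?M. (if x \<in> cylinder (J l) \<omega> then f x else 0))" for f :: "_ \<Rightarrow> real" and l
    by (rule integral_restrict[OF sub S(2,1), symmetric])
  have [measurable]: "u \<in> borel_measurable ?M"
    using V_spaceD(1)[OF V(1)] .
  have meas: "(\<lambda>x. if x \<in> cylinder (J l) \<omega> then f x else 0) \<in> borel_measurable ?M"
    if "f \<in> borel_measurable ?M" for f :: "_ \<Rightarrow> real" and l
    by (subst borel_measurable_if_lebesgue_on[OF S(2,1) sub]) (rule measurable_restrict_mono[OF that sub])
  have energy_le: "energy (J l) g \<le> energy I g" for l
    unfolding energy_def by (rule integral_mono_lebesgue_on_AE[OF integrable_energy_density[OF V(1) I]])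
      (use sub S in \<open>auto simp: energy_density_def\<close>)
  have "((\<lambda>l. LINT x|?M. (if x \<in> cylinder (J l) \<omega> then \<bar>u x\<bar> powr p else 0)) \<longlongrightarrow> (LINT x|?M. \<bar>u x\<bar> powr p)) at_top"
  proof (rule integral_dominated_convergence_at_top[where w = "\<lambda>x. \<bar>u x\<bar> powr p"])
    show "AE x in ?M. ((\<lambda>l. if x \<in> cylinder (J l) \<omega> then \<bar>u x\<bar> powr p else 0) \<longlongrightarrow> \<bar>u x\<bar> powr p) at_top"
    proof (rule AE_I2)
      fix x assume "x \<in> space ?M"
      then have "x $ None \<in> I" "tail x \<in> \<omega>"
        by (auto simp: cylinder_iff)
      then have "\<forall>\<^sub>F l in at_top. (if x \<in> cylinder (J l) \<omega> then \<bar>u x\<bar> powr p else 0) = \<bar>u x\<bar> powr p"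
        by (intro eventually_mono[OF exh]) (auto simp: cylinder_iff)
      then show "((\<lambda>l. if x \<in> cylinder (J l) \<omega> then \<bar>u x\<bar> powr p else 0) \<longlongrightarrow> \<bar>u x\<bar> powr p) at_top"
        by (rule tendsto_eventually)
    qed
  qed (use V_spaceD(3)[OF V(1)] in \<open>auto intro!: meas\<close>)
  then have "((\<lambda>l. y * mass (J l) u) \<longlongrightarrow> y * mass I u) at_top"
    unfolding mass_def restrict by (intro tendsto_intros)
  moreover have "energy I g < y * mass I u"
    using y pos by (simp add: q field_simps)
  ultimately have "\<forall>\<^sub>F l in at_top. energy I g < y * mass (J l) u"
    by (rule order_tendstoD(1))
  then show ?thesis
  proof eventually_elim
    case (elim l)
    have "mass (J l) u \<noteq> 0"
      using elim energy_nonneg[of I g] by auto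
    moreover from this have "0 < mass (J l) u"
      using mass_nonneg[of "J l" u] by simp
    with elim energy_le[of l] have "energy (J l) g / mass (J l) u < y"
      by (simp add: field_simps)
    ultimately show ?case
      using V_space_subset[OF V(1) p_ge_1 open_section I J(1) J(2)] by (auto simp: rayleigh_quotients_def)
  qed
qed

text \<open>The infimum over the empty set is an unspecified number, so competitors must be known to exist on
all cylinders in question or on none. A competitor on the smaller cylinder yields one on the larger by
ever steeper cutoffs near the end that is opened: if all the products vanished, so would the function.\<close>
lemma rayleigh_quotients_extend_nonempty:
  fixes s t :: "nat \<Rightarrow> real"
  assumes I: "open I" and J: "open J" "I \<subseteq> J"
    and vanish: "\<And>k r. r \<in> J \<Longrightarrow> - 1 < s k * r + t k \<Longrightarrow> r \<in> I"
    and exh: "\<And>r. r \<in> I \<Longrightarrow> \<exists>k. 1 \<le> s k * r + t k"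
    and ne: "rayleigh_quotients I \<noteq> {}"
  shows "rayleigh_quotients J \<noteq> {}"
proof
  assume empty: "rayleigh_quotients J = {}"
  obtain u g where V: "(u, g) \<in> V_space p \<omega> I" "mass I u \<noteq> 0"
    using ne by (auto simp: rayleigh_quotients_def)
  have "AE x in lebesgue_on (cylinder J \<omega>). ramp (s k * x $ None + t k) * u x = 0" for k
  proof -
    note W = V_space_ramp[where s = "s k" and t = "t k",
        OF V(1) p_ge_1 open_section I J(1) zero_less_one vanish[where k = k]]
    then have "mass J (\<lambda>x. ramp (s k * x $ None + t k) * u x) = 0"
      using empty by (auto simp: rayleigh_quotients_def)
    then show ?thesis
      using mass_eq_0_iff[OF W] by simp
  qed
  then have "AE x in lebesgue_on (cylinder J \<omega>). \<forall>k. ramp (s k * x $ None + t k) * u x = 0"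
    unfolding AE_all_countable by blast
  then have "AE x in lebesgue. x \<in> cylinder J \<omega> \<longrightarrow> (\<forall>k. ramp (s k * x $ None + t k) * u x = 0)"
    using cylinder_sets[OF J(1)] by (subst (asm) AE_restrict_space_iff) auto
  then have "AE x in lebesgue. x \<in> cylinder I \<omega> \<longrightarrow> u x = 0"
  proof eventually_elim
    case (elim x)
    show ?case
    proof
      assume x: "x \<in> cylinder I \<omega>"
      then obtain k where "1 \<le> s k * x $ None + t k"
        using exh by (auto simp: cylinder_iff)
      moreover have "ramp (s k * x $ None + t k) * u x = 0"
        using elim x J(2) by (auto simp: cylinder_iff)
      ultimately show "u x = 0"
        by (simp add: ramp_eq_1)
    qed
  qed
  then have "AE x in lebesgue_on (cylinder I \<omega>). u x = 0"
    using cylinder_sets[OF I] by (subst AE_restrict_space_iff) auto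
  then show False
    using V mass_eq_0_iff by blast
qed

section \<open>Splitting along a slab\<close>

lemma pigeonhole_slab:
  fixes h :: "real ^ ('m option) \<Rightarrow> real"
  assumes h: "integrable (lebesgue_on U) h" and h0: "\<And>x. 0 \<le> h x" and U: "U \<in> sets lebesgue" and N: "0 < N"
  obtains j where "j \<in> {1..N}"
    "(LINT x|lebesgue_on U. indicator {real j..<real j + 1} (x $ None) * h x) \<le>
      (LINT x|lebesgue_on U. h x) / real N"
proof -
  let ?f = "\<lambda>j x. indicator {real j..<real j + 1} (x $ None) * h x"
  have m: "(\<lambda>x :: real ^ ('m option). indicator {a..<b} (x $ None) :: real) \<in> borel_measurable (lebesgue_on U)"
    for a b :: real
    by (intro measurable_restrict_space1 measurable_completion) simp
  have i: "integrable (lebesgue_on U) (?f j)" for j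
    by (rule Bochner_Integration.integrable_bound[OF h])
      (use m h h0 in \<open>auto simp: indicator_def intro!: borel_measurable_times\<close>)
  have ind: "(\<Sum>j\<in>{1..n}. indicator {real j..<real j + 1} r) = (indicator {1..<real n + 1} r :: real)" for n r
    by (induction n) (auto simp: indicator_def)
  have "(\<Sum>j\<in>{1..N}. integral\<^sup>L (lebesgue_on U) (?f j)) = (LINT x|lebesgue_on U. (\<Sum>j\<in>{1..N}. ?f j x))"
    by (rule Bochner_Integration.integral_sum[symmetric]) (rule i)
  also have "\<dots> \<le> (LINT x|lebesgue_on U. h x)"
  proof (intro integral_mono h Bochner_Integration.integrable_sum i)
    show "(\<Sum>j\<in>{1..N}. ?f j x) \<le> h x" for x
      using h0[of x] unfolding sum_distrib_right[symmetric] ind by (simp add: indicator_def)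
  qed
  finally have le: "(\<Sum>j\<in>{1..N}. integral\<^sup>L (lebesgue_on U) (?f j)) \<le> integral\<^sup>L (lebesgue_on U) h" .
  have "\<exists>j\<in>{1..N}. integral\<^sup>L (lebesgue_on U) (?f j) \<le> integral\<^sup>L (lebesgue_on U) h / real N"
  proof (rule ccontr)
    assume "\<not> ?thesis"
    then have "(\<Sum>j\<in>{1..N}. integral\<^sup>L (lebesgue_on U) h / real N) < (\<Sum>j\<in>{1..N}. integral\<^sup>L (lebesgue_on U) (?f j))"
      using N by (intro sum_strict_mono) (auto simp: not_le)
    then show False
      using le N by simp
  qed
  then show ?thesis
    using that by blast
qed

text \<open>Bounds the energy of the two cut-off parts together inside the slab, as a multiple of
\<open>\<integral> |u|\<^sup>p + |\<nabla>u|\<^sup>p\<close> there: \<open>norm_cutoff_gradient_powr_le\<close> with the slope bound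
\<open>2\<close> of the ramp, applied to each part.\<close>
definition cut_constant :: real where
  "cut_constant = 2 * (C powr (p / 2) * (2 powr p * (1 + 2 powr p)))"

lemma cut_constant_nonneg: "0 \<le> cut_constant"
  by (simp add: cut_constant_def)

text \<open>Left of the slab the left part is \<open>u\<close> and the right part is zero, and conversely on the right.
Energies and masses are therefore additive outside the slab. Inside, nothing better than a
crude bound by the content \<open>E\<close> of the slab is needed, because \<open>E\<close> will be small.\<close>
lemma split_along_slab:
  fixes j L :: real
  assumes V: "(u, g) \<in> V_space p \<omega> {0<..<L}" and j: "1 \<le> j" "j + 1 < L"
    and h: "h = (\<lambda>x. \<bar>u x\<bar> powr p + norm (g x) powr p)"
    and E: "E = (LINT x|lebesgue_on (cylinder {0<..<L} \<omega>). indicator {j..<j + 1} (x $ None) * h x)"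
  obtains uL gL uR gR where
    "(uL, gL) \<in> V_space p \<omega> {0<..}" "(uR, gR) \<in> V_space p \<omega> {..<L}"
    "mass {0<..<L} u \<le> mass {0<..} uL + mass {..<L} uR + E"
    "energy {0<..} gL + energy {..<L} gR \<le> energy {0<..<L} g + cut_constant * E"
proof -
  let ?U = "cylinder {0<..<L} \<omega>"
  let ?a = "\<lambda>x :: real ^ ('m option). - 1 * x $ None + (j + 1)"
  let ?b = "\<lambda>x :: real ^ ('m option). 1 * x $ None + (- j)"
  let ?e = "axis None 1 :: real ^ ('m option)"
  let ?\<chi> = "\<lambda>x. indicator {j..<j + 1} (x $ None) :: real"
  define uL where "uL x = ramp (?a x) * u x" for x
  define uR where "uR x = ramp (?b x) * u x" for x
  define gL where "gL x = ramp (?a x) *\<^sub>R g x + u x *\<^sub>R (- 1 * ramp' (?a x)) *\<^sub>R ?e" for x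
  define gR where "gR x = ramp (?b x) *\<^sub>R g x + u x *\<^sub>R (1 * ramp' (?b x)) *\<^sub>R ?e" for x
  have VL: "(uL, gL) \<in> V_space p \<omega> {0<..}"
    unfolding uL_def[abs_def] gL_def[abs_def]
    by (rule V_space_ramp[OF V p_ge_1 open_section, where \<epsilon> = "L - (j + 1)"]) (use j in auto)
  have VR: "(uR, gR) \<in> V_space p \<omega> {..<L}"
    unfolding uR_def[abs_def] gR_def[abs_def]
    by (rule V_space_ramp[OF V p_ge_1 open_section, where \<epsilon> = 1]) (use j in auto)
  have right: "uL x = 0" "gL x = 0" "uR x = u x" "gR x = g x" if "j + 1 \<le> x $ None" for x
    using that by (simp_all add: uL_def gL_def uR_def gR_def ramp_eq_0 ramp_eq_1 ramp'_eq_0)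
  have left: "uR x = 0" "gR x = 0" "uL x = u x" "gL x = g x" if "x $ None \<le> j" for x
    using that by (simp_all add: uL_def gL_def uR_def gR_def ramp_eq_0 ramp_eq_1 ramp'_eq_0)
  have U: "?U \<in> sets lebesgue" "cylinder {0<..} \<omega> \<in> sets lebesgue" "cylinder {..<L} \<omega> \<in> sets lebesgue"
    by (intro cylinder_sets open_greaterThanLessThan open_greaterThan open_lessThan)+
  have zL: "uL x = 0" "gL x = 0" if "x \<in> cylinder {0<..} \<omega>" "x \<notin> ?U" for x
    using that right j by (auto simp: cylinder_iff)
  have zR: "uR x = 0" "gR x = 0" if "x \<in> cylinder {..<L} \<omega>" "x \<notin> ?U" for x
    using that left j by (auto simp: cylinder_iff)
  have subU: "x \<in> cylinder {0<..} \<omega>" "x \<in> cylinder {..<L} \<omega>" if "x \<in> ?U" for x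
    using that by (auto simp: cylinder_iff)
  have d0: "energy_density G x = 0" if "G x = 0" for G x
    using that by (simp add: energy_density_def)
  \<comment> \<open>both parts vanish on the half-cylinders outside \<open>?U\<close>, so all integrals become integrals over \<open>?U\<close>\<close>
  have mL: "mass {0<..} uL = (LINT x|lebesgue_on ?U. \<bar>uL x\<bar> powr p)"
    and iL: "integrable (lebesgue_on ?U) (\<lambda>x. \<bar>uL x\<bar> powr p)"
    using lebesgue_on_eq_off_common_part(1,2)[OF U(2,1), of "\<lambda>x. \<bar>uL x\<bar> powr p"] V_spaceD(3)[OF VL] zL subU
    by (auto simp: mass_def)
  have mR: "mass {..<L} uR = (LINT x|lebesgue_on ?U. \<bar>uR x\<bar> powr p)"
    and iR: "integrable (lebesgue_on ?U) (\<lambda>x. \<bar>uR x\<bar> powr p)"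
    using lebesgue_on_eq_off_common_part(1,2)[OF U(3,1), of "\<lambda>x. \<bar>uR x\<bar> powr p"] V_spaceD(3)[OF VR] zR subU
    by (auto simp: mass_def)
  have eL: "energy {0<..} gL = (LINT x|lebesgue_on ?U. energy_density gL x)"
    and jL: "integrable (lebesgue_on ?U) (energy_density gL)"
    using lebesgue_on_eq_off_common_part(1,2)[OF U(2,1), of "energy_density gL"]
      integrable_energy_density[OF VL open_greaterThan] zL subU d0
    by (auto simp: energy_def)
  have eR: "energy {..<L} gR = (LINT x|lebesgue_on ?U. energy_density gR x)"
    and jR: "integrable (lebesgue_on ?U) (energy_density gR)"
    using lebesgue_on_eq_off_common_part(1,2)[OF U(3,1), of "energy_density gR"]
      integrable_energy_density[OF VR open_lessThan] zR subU d0
    by (auto simp: energy_def)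
  have iu: "integrable (lebesgue_on ?U) (\<lambda>x. \<bar>u x\<bar> powr p)"
    and ig: "integrable (lebesgue_on ?U) (energy_density g)"
    and ih: "integrable (lebesgue_on ?U) h"
    using V_spaceD(3,4)[OF V] integrable_energy_density[OF V open_greaterThanLessThan] by (auto simp: h)
  have h0: "0 \<le> h x" for x
    by (simp add: h)
  have m\<chi>: "(\<lambda>x. ?\<chi> x) \<in> borel_measurable (lebesgue_on ?U)"
    by (intro measurable_restrict_space1 measurable_completion) simp
  have i\<chi>: "integrable (lebesgue_on ?U) (\<lambda>x. ?\<chi> x * h x)"
    by (rule Bochner_Integration.integrable_bound[OF ih])
      (use m\<chi> ih h0 in \<open>auto simp: indicator_def intro!: borel_measurable_times\<close>)
  have le_mass: "\<bar>u x\<bar> powr p \<le> \<bar>uL x\<bar> powr p + \<bar>uR x\<bar> powr p + ?\<chi> x * h x" for x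
    using left[of x] right[of x] by (cases "x $ None < j"; cases "j + 1 \<le> x $ None") (auto simp: h)
  have cut: "norm (G x) powr p \<le> 2 powr p * (1 + 2 powr p) * h x" if "G = gL \<or> G = gR" for G x
  proof -
    have r: "\<bar>ramp t\<bar> \<le> 1" "\<bar>ramp' t\<bar> \<le> 2" for t
      using ramp_nonneg[of t] ramp_le_1[of t] abs_ramp'_le[of t] by auto
    have "norm (G x) powr p \<le> 2 powr p * (norm (g x) powr p + 2 powr p * \<bar>u x\<bar> powr p)"
      using that p_ge_1 unfolding gL_def[abs_def] gR_def[abs_def]
      by (elim disjE; simp only:) (rule norm_cutoff_gradient_powr_le; use r in simp)+
    also have "\<dots> \<le> 2 powr p * ((1 + 2 powr p) * h x)"
      by (intro mult_left_mono) (auto simp: h algebra_simps)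
    finally show ?thesis
      by simp
  qed
  have le_energy: "AE x in lebesgue_on ?U. energy_density gL x + energy_density gR x \<le>
      energy_density g x + cut_constant * (?\<chi> x * h x)"
    using AE_energy_bounds[OF open_greaterThanLessThan[of 0 L]]
  proof eventually_elim
    case (elim x)
    have "energy_density G x \<le> C powr (p / 2) * (2 powr p * (1 + 2 powr p) * h x)" if "G = gL \<or> G = gR" for G
      using elim cut[OF that, of x] order_trans[OF _ mult_left_mono] by (meson powr_ge_zero)
    from this[of gL] this[of gR] have sum: "energy_density gL x + energy_density gR x \<le> cut_constant * h x"
      by (simp add: cut_constant_def algebra_simps)
    have "energy_density gL x = energy_density g x" "energy_density gR x = 0" if "x $ None < j"
      using left[of x] that by (simp_all add: energy_density_def)
    moreover have "energy_density gR x = energy_density g x" "energy_density gL x = 0" if "j + 1 \<le> x $ None"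
      using right[of x] that by (simp_all add: energy_density_def)
    moreover have "0 \<le> energy_density g x"
      by (simp add: energy_density_def)
    ultimately show ?case
      using sum by (cases "x $ None < j"; cases "j + 1 \<le> x $ None") auto
  qed
  have "mass {0<..<L} u \<le> (LINT x|lebesgue_on ?U. \<bar>uL x\<bar> powr p + \<bar>uR x\<bar> powr p + ?\<chi> x * h x)"
    unfolding mass_def using le_mass iu iL iR i\<chi> by (intro integral_mono) auto
  also have "\<dots> = mass {0<..} uL + mass {..<L} uR + E"
    using iL iR i\<chi> by (simp add: mL mR E)
  finally have mass: "mass {0<..<L} u \<le> mass {0<..} uL + mass {..<L} uR + E" .
  have "energy {0<..} gL + energy {..<L} gR = (LINT x|lebesgue_on ?U. energy_density gL x + energy_density gR x)"
    using jL jR by (simp add: eL eR)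
  also have "\<dots> \<le> (LINT x|lebesgue_on ?U. energy_density g x + cut_constant * (?\<chi> x * h x))"
    using le_energy jL jR ig i\<chi> by (intro integral_mono_AE) auto
  also have "\<dots> = energy {0<..<L} g + cut_constant * E"
    using ig i\<chi> by (simp add: energy_def E)
  finally show ?thesis
    using that[OF VL VR mass] by blast
qed

lemma inf_rayleigh_shift_intervals:
  "inf_rayleigh p A \<omega> {..<L} = inf_rayleigh p A \<omega> {..<0}"
  "inf_rayleigh p A \<omega> {- l<..<l} = inf_rayleigh p A \<omega> {0<..<2 * l}"
  "rayleigh_quotients {- (2 * l)<..<0} = rayleigh_quotients {0<..<2 * l}"
proof -
  have "{r. r + L \<in> {..<L}} = {..<0}" "{r. r + l \<in> {0<..<2 * l}} = {- l<..<l}"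
    "{r. r + 2 * l \<in> {0<..<2 * l}} = {- (2 * l)<..<0}" for l :: real
    by auto
  then show "inf_rayleigh p A \<omega> {..<L} = inf_rayleigh p A \<omega> {..<0}"
    "inf_rayleigh p A \<omega> {- l<..<l} = inf_rayleigh p A \<omega> {0<..<2 * l}"
    "rayleigh_quotients {- (2 * l)<..<0} = rayleigh_quotients {0<..<2 * l}"
    using rayleigh_quotients_shift[of "{..<L}" L] rayleigh_quotients_shift[of "{0<..<2 * l}" l]
      rayleigh_quotients_shift[of "{0<..<2 * l}" "2 * l"]
    by (simp_all add: inf_rayleigh_eq)
qed

text \<open>Apply the half-cylinder infima to the two parts of \<open>u\<close> and add. The error is a multiple of the
content of the chosen slab, which coercivity bounds by \<open>(1 + q / lam\<^sup>p\<^sup>/\<^sup>2) / N\<close> times the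
mass of \<open>u\<close>.\<close>
lemma rayleigh_quotient_lower_bound:
  fixes L :: real and N :: nat
  assumes m: "0 \<le> m" "m \<le> inf_rayleigh p A \<omega> {0<..}" "m \<le> inf_rayleigh p A \<omega> {..<0}"
    and N: "0 < N" "real N + 1 < L" and q: "q \<in> rayleigh_quotients {0<..<L}"
  shows "m \<le> q + (cut_constant + m) * (1 + q / lam powr (p / 2)) / real N"
proof -
  let ?U = "cylinder {0<..<L} \<omega>"
  obtain u g where V: "(u, g) \<in> V_space p \<omega> {0<..<L}" "mass {0<..<L} u \<noteq> 0"
    and q: "q = energy {0<..<L} g / mass {0<..<L} u"
    using q by (auto simp: rayleigh_quotients_def)
  let ?D = "mass {0<..<L} u" and ?N = "energy {0<..<L} g"
  have D: "0 < ?D"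
    using V(2) mass_nonneg[of "{0<..<L}" u] by simp
  define h where "h = (\<lambda>x. \<bar>u x\<bar> powr p + norm (g x) powr p)"
  note i = V_spaceD(3,4)[OF V(1)]
  have "lam powr (p / 2) * (LINT x|lebesgue_on ?U. norm (g x) powr p) \<le> ?N"
    unfolding energy_def integral_mult_right_zero[symmetric]
    by (rule integral_mono_AE)
      (use i integrable_energy_density[OF V(1)] AE_energy_bounds[of "{0<..<L}"] in auto)
  then have "(LINT x|lebesgue_on ?U. norm (g x) powr p) \<le> ?N / lam powr (p / 2)"
    using lam_pos by (simp add: field_simps)
  then have h_le: "integral\<^sup>L (lebesgue_on ?U) h \<le> ?D + ?N / lam powr (p / 2)"
    using i by (simp add: h_def mass_def)
  have "integrable (lebesgue_on ?U) h" "0 \<le> h x" for x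
    using i by (auto simp: h_def)
  then obtain j where j: "j \<in> {1..N}"
    and jE: "(LINT x|lebesgue_on ?U. indicator {real j..<real j + 1} (x $ None) * h x) \<le>
      integral\<^sup>L (lebesgue_on ?U) h / real N"
    using pigeonhole_slab[of ?U h N] cylinder_sets N by auto
  define E where "E = (LINT x|lebesgue_on ?U. indicator {real j..<real j + 1} (x $ None) * h x)"
  have E: "E \<le> (?D + ?N / lam powr (p / 2)) / real N"
    using jE divide_right_mono[OF h_le, of "real N"] by (simp add: E_def)
  have jL: "1 \<le> real j" "real j + 1 < L"
    using j N by auto
  obtain uL gL uR gR where s: "(uL, gL) \<in> V_space p \<omega> {0<..}" "(uR, gR) \<in> V_space p \<omega> {..<L}"
    "?D \<le> mass {0<..} uL + mass {..<L} uR + E"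
    "energy {0<..} gL + energy {..<L} gR \<le> ?N + cut_constant * E"
    using split_along_slab[OF V(1) jL h_def E_def] by metis
  have "m * ?D \<le> m * mass {0<..} uL + m * mass {..<L} uR + m * E"
    using mult_left_mono[OF s(3) m(1)] by (simp add: algebra_simps)
  also have "\<dots> \<le> energy {0<..} gL + energy {..<L} gR + m * E"
  proof (intro add_mono order_refl)
    show "m * mass {0<..} uL \<le> energy {0<..} gL"
      using mult_right_mono[OF m(2) mass_nonneg] inf_rayleigh_mult_mass_le[OF s(1)] by (rule order_trans)
    show "m * mass {..<L} uR \<le> energy {..<L} gR"
      using mult_right_mono[OF m(3) mass_nonneg] inf_rayleigh_mult_mass_le[OF s(2)]
      unfolding inf_rayleigh_shift_intervals(1)[of L] by (rule order_trans)
  qed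
  also have "\<dots> \<le> ?N + (cut_constant + m) * E"
    using s(4) by (simp add: algebra_simps)
  also have "\<dots> \<le> ?N + (cut_constant + m) * ((?D + ?N / lam powr (p / 2)) / real N)"
    using E m(1) cut_constant_nonneg by (intro add_left_mono mult_left_mono) auto
  finally have "m * ?D / ?D \<le> (?N + (cut_constant + m) * ((?D + ?N / lam powr (p / 2)) / real N)) / ?D"
    using D by (intro divide_right_mono) auto
  also have "\<dots> = q + (cut_constant + m) * (1 + q / lam powr (p / 2)) / real N"
    unfolding q using D N(1) lam_pos by (simp add: field_simps)
  finally show ?thesis
    using D by simp
qed

section \<open>The limit\<close>

text \<open>If no cylinder over \<open>(0,L)\<close> carries a competitor, neither does a half-cylinder, and all infima are the
same infimum of the empty set. Otherwise competitors exist on both half-cylinders, and the two bounds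
apply.\<close>
theorem tendsto_inf_rayleigh_min_half_lines:
  "((\<lambda>l. inf_rayleigh p A \<omega> {- l<..<l}) \<longlongrightarrow>
    min (inf_rayleigh p A \<omega> {0<..}) (inf_rayleigh p A \<omega> {..<0})) at_top"
proof -
  let ?R = rayleigh_quotients and ?I = "inf_rayleigh p A \<omega>"
  have plus: "\<forall>\<^sub>F l in at_top. \<exists>q' \<in> ?R {0<..<2 * l}. q' < y" if "q \<in> ?R {0<..}" "q < y" for q y
  proof (rule rayleigh_quotients_exhaustion[OF open_greaterThan _ _ _ that])
    show "\<forall>\<^sub>F l in at_top. r \<in> {0<..<2 * l}" if "r \<in> {0<..}" for r :: real
      using eventually_gt_at_top[of "r / 2"] that by (auto elim: eventually_mono)
  qed auto
  have minus: "\<forall>\<^sub>F l in at_top. \<exists>q' \<in> ?R {0<..<2 * l}. q' < y" if "q \<in> ?R {..<0}" "q < y" for q y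
    unfolding inf_rayleigh_shift_intervals(3)[symmetric]
  proof (rule rayleigh_quotients_exhaustion[OF open_lessThan _ _ _ that])
    show "\<forall>\<^sub>F l in at_top. r \<in> {- (2 * l)<..<0}" if "r \<in> {..<0}" for r :: real
      by (rule eventually_mono[OF eventually_gt_at_top[of "- r / 2"]]) (use that in auto)
  qed auto
  show ?thesis
  proof (cases "\<forall>L > 0. ?R {0<..<L} = {}")
    case True
    have "\<not> (\<forall>\<^sub>F l in at_top. \<exists>q' \<in> ?R {0<..<2 * l}. q' < y)" for y
    proof
      assume "\<forall>\<^sub>F l in at_top. \<exists>q' \<in> ?R {0<..<2 * l}. q' < y"
      then have "\<forall>\<^sub>F l :: real in at_top. False"
        using eventually_gt_at_top[of 0] by eventually_elim (use True in auto)
      then show False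
        by simp
    qed
    then have "?R {0<..} = {}" "?R {..<0} = {}"
      using plus minus less_add_one by blast+
    moreover have "\<forall>\<^sub>F l in at_top. ?I {- l<..<l} = Inf {}"
      using eventually_gt_at_top[of 0]
      by eventually_elim (use True in \<open>simp add: inf_rayleigh_shift_intervals(2) inf_rayleigh_eq[of "{0<..<_}"]\<close>)
    ultimately show ?thesis
      by (simp add: inf_rayleigh_eq[of "{0<..}"] inf_rayleigh_eq[of "{..<0}"] tendsto_eventually)
  next
    case False
    then obtain L where L: "L > 0" "?R {0<..<L} \<noteq> {}" by auto
    have large: "\<exists>k. c < real k * d" if "0 < d" for c d :: real
      using reals_Archimedean3[OF that] by blast
    \<comment> \<open>cutoffs near the right end: zero where \<open>L - r \<le> 1/k\<close>, one where \<open>L - r \<ge> 2/k\<close>\<close>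
    have "?R {0<..} \<noteq> {}"
    proof (rule rayleigh_quotients_extend_nonempty[OF open_greaterThanLessThan open_greaterThan _ _ _ L(2)])
      show "r \<in> {0<..<L}" if "r \<in> {0<..}" "- 1 < - real k * r + (real k * L - 1)" for r k
      proof -
        have "0 < real k * (L - r)"
          using that by (simp add: algebra_simps)
        then show ?thesis
          using that by (simp add: zero_less_mult_iff)
      qed
      show "\<exists>k. 1 \<le> - real k * r + (real k * L - 1)" if "r \<in> {0<..<L}" for r
        using large[of "L - r" 2] that by (auto simp: algebra_simps intro: less_imp_le)
    qed auto
    then obtain q1 where q1: "q1 \<in> ?R {0<..}" by blast
    have "?R {..<L} \<noteq> {}"
    proof (rule rayleigh_quotients_extend_nonempty[OF open_greaterThanLessThan open_lessThan _ _ _ L(2)])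
      show "r \<in> {0<..<L}" if "r \<in> {..<L}" "- 1 < real k * r + (- 1)" for r k
        using that by (simp add: zero_less_mult_iff)
      show "\<exists>k. 1 \<le> real k * r + (- 1)" if "r \<in> {0<..<L}" for r
        using large[of r 2] that by (auto intro: less_imp_le)
    qed auto
    then have ne: "?R {0<..} \<noteq> {}" "?R {..<0} \<noteq> {}"
      using q1 rayleigh_quotients_shift[OF open_lessThan, of L L] by (auto simp: lessThan_def)
    define m where "m = min (?I {0<..}) (?I {..<0})"
    have m: "0 \<le> m" "m \<le> ?I {0<..}" "m \<le> ?I {..<0}"
      using inf_rayleigh_nonneg ne by (auto simp: m_def)
    show ?thesis
      unfolding m_def[symmetric] inf_rayleigh_shift_intervals(2)
    proof (rule order_tendstoI)
      fix y assume y: "m < y"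
      have "\<forall>\<^sub>F l in at_top. \<exists>q' \<in> ?R {0<..<2 * l}. q' < y"
      proof (cases "?I {0<..} < y")
        case True
        then obtain q where "q \<in> ?R {0<..}" "q < y"
          using cInf_lessD[OF ne(1)] by (auto simp: inf_rayleigh_eq)
        then show ?thesis by (rule plus)
      next
        case False
        then have "?I {..<0} < y"
          using y by (auto simp: m_def)
        then obtain q where "q \<in> ?R {..<0}" "q < y"
          using cInf_lessD[OF ne(2)] by (auto simp: inf_rayleigh_eq)
        then show ?thesis by (rule minus)
      qed
      then show "\<forall>\<^sub>F l in at_top. ?I {0<..<2 * l} < y"
      proof eventually_elim
        case (elim l)
        then show ?case
          unfolding inf_rayleigh_eq using cInf_lower[OF _ bdd_below_rayleigh_quotients] by force
      qed
    next
      fix y assume y: "y < m"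
      define c where "c = lam powr (p / 2)"
      define M where "M = cut_constant + m"
      have c: "0 < c" and M: "0 \<le> M"
        using lam_pos cut_constant_nonneg m(1) by (auto simp: c_def M_def)
      \<comment> \<open>the lower bound \<open>m \<le> q + M (1 + q / c) / N\<close> solved for \<open>q\<close>\<close>
      define f where "f N = (m - M / real N) / (1 + M / c / real N)" for N
      have "f \<longlonglongrightarrow> (m - 0) / (1 + 0)"
        unfolding f_def by (intro tendsto_intros lim_const_over_n) auto
      then have "\<forall>\<^sub>F N in sequentially. y < f N"
        using y by (intro order_tendstoD(1)) auto
      then obtain N where N: "y < f N" "0 < N"
        using eventually_happens'[OF sequentially_bot eventually_conj[OF _ eventually_gt_at_top[of 0]]] by blast
      have lower: "f N \<le> q" if "q \<in> ?R {0<..<L}" "real N + 1 < L" for q L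
      proof -
        have "m \<le> q + M * (1 + q / c) / real N"
          using rayleigh_quotient_lower_bound[OF m N(2) that(2,1)] by (simp add: M_def c_def)
        then have "m - M / real N \<le> q * (1 + M / c / real N)"
          by (simp add: algebra_simps add_divide_distrib)
        moreover have "0 < 1 + M / c / real N"
          using c M N(2) by (simp add: add_pos_nonneg)
        ultimately show ?thesis
          by (simp add: f_def pos_divide_le_eq)
      qed
      show "\<forall>\<^sub>F l in at_top. y < ?I {0<..<2 * l}"
        using plus[OF q1, of "q1 + 1", simplified] eventually_gt_at_top[of "real N + 1"]
      proof eventually_elim
        case (elim l)
        then have "f N \<le> ?I {0<..<2 * l}"
          unfolding inf_rayleigh_eq by (intro cInf_greatest lower[where L = "2 * l"]) auto
        then show ?case
          using N(1) by simp
      qed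
    qed
  qed
qed

end

theorem theorem1p2:
  fixes \<omega> :: "(real ^ 'm::finite) set"
    and A :: "real ^ 'm \<Rightarrow> real ^ ('m option) ^ ('m option)"
    and C lam p :: real
  assumes "open \<omega>" and "bounded \<omega>"
    and "\<And>X. X \<in> \<omega> \<Longrightarrow> transpose (A X) = A X"
    and "\<And>i j. (\<lambda>X. A X $ i $ j) \<in> borel_measurable (lebesgue_on \<omega>)"
    and "C > 0" and "lam > 0"
    and "AE X in lebesgue_on \<omega>. onorm (\<lambda>\<xi>. A X *v \<xi>) \<le> C"
    and "AE X in lebesgue_on \<omega>. \<forall>\<xi>. (A X *v \<xi>) \<bullet> \<xi> \<ge> lam * (norm \<xi>)\<^sup>2"
    and "p \<ge> 2"
  shows "((\<lambda>l. lambda_M p A \<omega> l) \<longlongrightarrow> min (nu_plus p A \<omega>) (nu_minus p A \<omega>)) at_top"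
proof -
  interpret elliptic_cylinder \<omega> A C lam p
    using assms by unfold_locales auto
  show ?thesis
    unfolding lambda_M_def nu_plus_def nu_minus_def by (rule tendsto_inf_rayleigh_min_half_lines)
qed

end
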